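(* Let $n\ge 2$ and $d\ge n+1$ be integers, let $f\in S_d$ be a Perazzo form of degree $d$ (so $V(f)\subset\mathbb{P}^{n+2}$ is a Perazzo hypersurface), and let $(h_0,h_1,\dots,h_d)$ be the $h$-vector of $A_f=R/\operatorname{Ann}_R(f)$. Then $A_f$ has the weak Lefschetz property if and only if $\#\{i \mid h_i=d+2\}\le 1$.
   Context: $K$ is an algebraically closed field of characteristic zero. $S=K[x_0,\dots,x_n,u,v]$ and $R=K[y_0,\dots,y_n,U,V]$ acts on $S$ by differentiation ($y_i=\partial/\partial x_i$, $U=\partial/\partial u$, $V=\partial/\partial v$); write $\theta\circ f$ for this action. A Perazzo form of degree $d$ is $f=x_0p_0+x_1p_1+\cdots+x_np_n+g$ where $p_0,\dots,p_n\in K[u,v]_{d-1}$ are linearly independent but algebraically dependent forms and $g\in K[u,v]_d$. $\operatorname{Ann}_R(f)=\{\theta\in R:\theta\circ f=0\}$ and $A_f=R/\operatorname{Ann}_R(f)$ is a graded artinian Gorenstein algebra of socle degree $d$; its $h$-vector is $h_i=\dim_K [A_f]_i$, which equals the dimension of the $K$-span of all order-$i$ partial derivatives of $f$, and satisfies $h_i=h_{d-i}$. A graded artinian algebra $A$ has the weak Lefschetz property (WLP) if there is $\ell\in[A]_1$ such that multiplication $\times\ell:[A]_i\to[A]_{i+1}$ has maximal rank (is injective or surjective) for every $i\ge 0$. *)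

theory Defs
  imports Main "HOL-Library.Poly_Mapping" "HOL-Computational_Algebra.Polynomial"
begin

text \<open>Multivariate polynomials over a field 'k: finitely supported maps from
monomials (exponent vectors, variable j has index j) to
coefficients.  Variables x_0..x_n have indices 0..n, u has index n+1,
v has index n+2.  The same type is used for R = K[y_0..y_n,U,V] (same indexing).\<close>

type_synonym 'k mpoly = "(nat \<Rightarrow>\<^sub>0 nat) \<Rightarrow>\<^sub>0 'k"

definition alg_closed_field :: "'k::field itself \<Rightarrow> bool" where
  "alg_closed_field _ \<longleftrightarrow> (\<forall>p::'k poly. degree p > 0 \<longrightarrow> (\<exists>x. poly p x = 0))"

definition cst :: "'k::zero \<Rightarrow> 'k mpoly" where
  "cst c = Poly_Mapping.single 0 c"

definition Var :: "nat \<Rightarrow> 'k::{zero,one} mpoly" where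
  "Var j = Poly_Mapping.single (Poly_Mapping.single j 1) 1"

definition mscale :: "'k::comm_ring_1 \<Rightarrow> 'k mpoly \<Rightarrow> 'k mpoly" where
  "mscale c p = cst c * p"

definition tdeg :: "(nat \<Rightarrow>\<^sub>0 nat) \<Rightarrow> nat" where
  "tdeg m = (\<Sum>j\<in>Poly_Mapping.keys m. Poly_Mapping.lookup m j)"

definition homog :: "nat \<Rightarrow> 'k::zero mpoly \<Rightarrow> bool" where
  "homog d p \<longleftrightarrow> (\<forall>m\<in>Poly_Mapping.keys p. tdeg m = d)"

definition vars_in :: "nat set \<Rightarrow> 'k::zero mpoly \<Rightarrow> bool" where
  "vars_in V p \<longleftrightarrow> (\<forall>m\<in>Poly_Mapping.keys p. Poly_Mapping.keys m \<subseteq> V)"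

definition forms :: "nat set \<Rightarrow> nat \<Rightarrow> 'k::zero mpoly set" where
  "forms V d = {p. vars_in V p \<and> homog d p}"

definition subst :: "(nat \<Rightarrow> 'k::comm_ring_1 mpoly) \<Rightarrow> 'k mpoly \<Rightarrow> 'k mpoly" where
  "subst s P = (\<Sum>m\<in>Poly_Mapping.keys P. cst (Poly_Mapping.lookup P m) * (\<Prod>j\<in>Poly_Mapping.keys m. s j ^ Poly_Mapping.lookup m j))"

definition pdiff :: "nat \<Rightarrow> 'k::comm_ring_1 mpoly \<Rightarrow> 'k mpoly" where
  "pdiff j P = (\<Sum>m\<in>Poly_Mapping.keys P.
      Poly_Mapping.single (m - Poly_Mapping.single j 1) (of_nat (Poly_Mapping.lookup m j) * Poly_Mapping.lookup P m))"

definition pdiffs :: "(nat \<Rightarrow>\<^sub>0 nat) \<Rightarrow> 'k::comm_ring_1 mpoly \<Rightarrow> 'k mpoly" where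
  "pdiffs m P = foldr (\<lambda>j Q. (pdiff j ^^ Poly_Mapping.lookup m j) Q) (sorted_list_of_set (Poly_Mapping.keys m)) P"

definition act :: "'k::comm_ring_1 mpoly \<Rightarrow> 'k mpoly \<Rightarrow> 'k mpoly" where
  "act \<theta> f = (\<Sum>m\<in>Poly_Mapping.keys \<theta>. cst (Poly_Mapping.lookup \<theta> m) * pdiffs m f)"

definition perazzo :: "nat \<Rightarrow> nat \<Rightarrow> (nat \<Rightarrow> 'k::comm_ring_1 mpoly) \<Rightarrow> 'k mpoly \<Rightarrow> bool" where
  "perazzo n d p g \<longleftrightarrow>
     (\<forall>i\<le>n. p i \<in> forms {n+1, n+2} (d - 1)) \<and>
     g \<in> forms {n+1, n+2} d \<and>
     (\<forall>c::nat \<Rightarrow> 'k. (\<Sum>i\<le>n. mscale (c i) (p i)) = 0 \<longrightarrow> (\<forall>i\<le>n. c i = 0)) \<and>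
     (\<exists>F::'k mpoly. F \<noteq> 0 \<and> vars_in {..n} F \<and> subst p F = 0)"

definition perazzo_form :: "nat \<Rightarrow> (nat \<Rightarrow> 'k::comm_ring_1 mpoly) \<Rightarrow> 'k mpoly \<Rightarrow> 'k mpoly" where
  "perazzo_form n p g = (\<Sum>i\<le>n. Var i * p i) + g"

abbreviation Rdeg :: "nat \<Rightarrow> nat \<Rightarrow> 'k::zero mpoly set" where
  "Rdeg n i \<equiv> forms {..n+2} i"

text \<open>h_i = dim_K [A_f]_i = dim of the K-span of the order-i partial derivatives of f\<close>
definition hvec :: "nat \<Rightarrow> 'k::field mpoly \<Rightarrow> nat \<Rightarrow> nat" where
  "hvec n f i = vector_space.dim mscale
      {pdiffs m f | m. Poly_Mapping.keys m \<subseteq> {..n+2} \<and> tdeg m = i}"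

text \<open>WLP for A_f = R / Ann_R(f): some l in [A_f]_1 (represented by a linear form
of R) such that multiplication by l from [A_f]_i to [A_f]_(i+1) is injective or
surjective for every i.  Injectivity/surjectivity on the quotients are unfolded:
classes of theta in R_i are equal iff theta - theta' is in Ann_R(f).\<close>
definition mult_injective :: "nat \<Rightarrow> 'k::field mpoly \<Rightarrow> 'k mpoly \<Rightarrow> nat \<Rightarrow> bool" where
  "mult_injective n f l i \<longleftrightarrow>
     (\<forall>\<theta>\<in>Rdeg n i. act (l * \<theta>) f = 0 \<longrightarrow> act \<theta> f = 0)"

definition mult_surjective :: "nat \<Rightarrow> 'k::field mpoly \<Rightarrow> 'k mpoly \<Rightarrow> nat \<Rightarrow> bool" where
  "mult_surjective n f l i \<longleftrightarrow>
     (\<forall>\<psi>\<in>Rdeg n (i+1). \<exists>\<theta>\<in>Rdeg n i. act (\<psi> - l * \<theta>) f = 0)"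

definition has_WLP :: "nat \<Rightarrow> 'k::field mpoly \<Rightarrow> bool" where
  "has_WLP n f \<longleftrightarrow> (\<exists>l\<in>Rdeg n 1. \<forall>i.
      mult_injective n f l i \<or> mult_surjective n f l i)"

end

theory Submission
  imports Defs
begin

text \<open>
  Let \<open>I\<close> be the common annihilator of \<open>p\<^sub>0, \<dots>, p\<^sub>n\<close> in \<open>K[U, V]\<close> and \<open>s\<close> its initial degree. Splitting
  derivatives of \<open>f\<close> by their degree in the \<open>x\<^sub>j\<close> shows \<open>h\<^sub>i \<le> d + 2\<close>, with equality iff
  \<open>I\<^sub>i = I\<^bsub>d-i\<^esub> = 0\<close>, that is \<open>d - s < i < s\<close>. At most one such \<open>i\<close> exists iff
  \<open>2 s \<le> d + 2\<close>.

  If \<open>2 s > d + 2\<close>, take \<open>i = d - s + 1\<close> and let \<open>L\<close> be the \<open>U, V\<close>-part of a linear form \<open>\<ell>\<close>. All of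
  \<open>K[u, v]\<^bsub>d-i\<^esub>\<close> consists of derivatives of the \<open>p\<^sub>j\<close>, in particular the power of a linear form killed
  by \<open>L\<close>, so \<open>\<times>\<ell>\<close> is not injective in degree \<open>i\<close>; and as \<open>I\<^bsub>i+1\<^esub> = 0\<close>, an operator in \<open>U, V\<close> not
  divisible by \<open>L\<close> is not in its image.

  If \<open>2 s \<le> d + 2\<close>, let \<open>\<eta> \<in> I\<^sub>s\<close> be nonzero and take \<open>\<ell> = U - z V\<close> for a general \<open>z\<close>. By Gorenstein duality it
  suffices that \<open>\<times>\<ell>\<close> is injective in degree \<open>i\<close> or in degree \<open>d - 1 - i\<close>. For \<open>i < s\<close> and \<open>d - i \<ge> s\<close> it is, essentially
  because \<open>\<eta>\<close> does not vanish at \<open>z\<close>. In the remaining range \<open>I\<^sub>i\<close>, \<open>I\<^bsub>i+1\<^esub>\<close> and \<open>I\<^bsub>d-i\<^esub>\<close> are generated by \<open>\<eta>\<close>, and the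
  question reduces to the weak Lefschetz property of the binary form obtained by applying \<open>\<eta>\<^sup>2\<close> to \<open>g\<close>.
\<close>

section \<open>Functionals on univariate polynomials and annihilators\<close>

declare mult_pCons_left [simp del] mult_pCons_right [simp del]

section \<open>Polynomials of bounded degree and division at a point\<close>

text \<open>The index counts coefficients, so \<open>pl (k + 1)\<close> models degree
  \<open>k\<close> and \<open>pl 0\<close> is the zero space. A condition on coefficients avoids the
  special role of \<open>0\<close> for \<open>degree\<close>.\<close>

definition pl :: "nat \<Rightarrow> 'k::zero poly set" where
  "pl k = {t. \<forall>a\<ge>k. coeff t a = 0}"

lemma pl_0 [simp]: "0 \<in> pl k"
  by (simp add: pl_def)

lemma pl_zero_iff: "t \<in> pl 0 \<longleftrightarrow> t = 0"
  by (auto simp: pl_def poly_eq_iff)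

lemma pl_iff_degree: "t \<in> pl k \<longleftrightarrow> t = 0 \<or> degree t < k"
proof
  show "t = 0 \<or> degree t < k" if "t \<in> pl k"
    using that by (metis (mono_tags, lifting) leading_coeff_0_iff mem_Collect_eq not_le_imp_less pl_def)
  show "t \<in> pl k" if "t = 0 \<or> degree t < k"
    using that by (auto simp: pl_def coeff_eq_0)
qed

lemma pl_mono: "t \<in> pl a \<Longrightarrow> a \<le> b \<Longrightarrow> t \<in> pl b"
  by (auto simp: pl_def)

lemma pl_add: "s \<in> pl k \<Longrightarrow> t \<in> pl k \<Longrightarrow> s + t \<in> pl k"
  by (simp add: pl_def)

lemma pl_diff: "s \<in> pl k \<Longrightarrow> t \<in> pl k \<Longrightarrow> s - t \<in> pl k"
  for s t :: "'k::ab_group_add poly"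
  by (simp add: pl_def)

lemma pl_smult: "t \<in> pl k \<Longrightarrow> smult c t \<in> pl k"
  by (simp add: pl_def)

lemma pl_sum: "(\<And>a. a \<in> A \<Longrightarrow> t a \<in> pl k) \<Longrightarrow> (\<Sum>a\<in>A. t a) \<in> pl k"
  for t :: "'a \<Rightarrow> 'k::ab_group_add poly"
  by (simp add: pl_def coeff_sum)

lemma pl_monom: "a < k \<Longrightarrow> monom c a \<in> pl k"
  by (auto simp: pl_def)

lemma pl_const: "0 < k \<Longrightarrow> [:c:] \<in> pl k"
  by (auto simp: pl_iff_degree)

lemma pl_mult: "s \<in> pl a \<Longrightarrow> t \<in> pl b \<Longrightarrow> a + b \<le> Suc c \<Longrightarrow> s * t \<in> pl c"
  for s t :: "'k::comm_semiring_0 poly"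
  unfolding pl_iff_degree using degree_mult_le[of s t] by auto

lemma pl_power_linear: "[:- z, 1:] ^ m \<in> pl (Suc m)"
  for z :: "'k::field"
  by (simp add: pl_iff_degree degree_linear_power)

lemma pl_cancel_power: "[:- z, 1:] ^ m * t \<in> pl (m + a) \<Longrightarrow> t \<in> pl a"
  for z :: "'k::field"
  by (cases "t = 0") (auto simp: pl_iff_degree degree_mult_eq degree_linear_power)

text \<open>Division with remainder at the point \<open>z\<close> instead of at infinity: a power of \<open>X - z\<close>
  takes the place of the degree condition on the remainder.\<close>

lemma division_at_point:
  fixes \<eta> \<sigma> :: "'k::field poly"
  assumes "poly \<eta> z \<noteq> 0"
  shows "\<exists>q\<in>pl m. \<exists>\<rho>. \<sigma> = \<eta> * q + [:- z, 1:] ^ m * \<rho>"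
proof (induction m)
  case 0
  then show ?case by (intro bexI[of _ 0] exI[of _ \<sigma>]) auto
next
  case (Suc m)
  then obtain q \<rho> where q: "q \<in> pl m" and eq: "\<sigma> = \<eta> * q + [:- z, 1:] ^ m * \<rho>"
    by blast
  define c where "c = poly \<rho> z / poly \<eta> z"
  have "poly (\<rho> - smult c \<eta>) z = 0"
    using assms by (simp add: c_def)
  then obtain \<rho>' where r: "\<rho> - smult c \<eta> = [:- z, 1:] * \<rho>'"
    by (metis poly_eq_0_iff_dvd dvdE)
  then have r': "\<rho> = smult c \<eta> + [:- z, 1:] * \<rho>'"
    by (metis add.commute diff_add_cancel)
  let ?q = "q + smult c ([:- z, 1:] ^ m)"
  have "?q \<in> pl (Suc m)"
    by (intro pl_add pl_smult pl_power_linear pl_mono[OF q]) auto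
  moreover have "\<sigma> = \<eta> * ?q + [:- z, 1:] ^ Suc m * \<rho>'"
    by (subst eq, subst r') (simp add: algebra_simps)
  ultimately show ?case by blast
qed

text \<open>Both \<open>\<sigma>\<close> and, as \<open>s \<le> a\<close>, also
  \<open>\<eta> * q\<close> lie in \<open>pl (m + a)\<close>. Hence so does the remainder term, and
  cancelling the power of \<open>X - z\<close> bounds \<open>\<rho>\<close>.\<close>

lemma division_at_point_bounded:
  fixes \<eta> \<sigma> :: "'k::field poly"
  assumes z: "poly \<eta> z \<noteq> 0" and \<eta>: "\<eta> \<in> pl (Suc s)" and \<sigma>: "\<sigma> \<in> pl (m + a)" and "s \<le> a"
  shows "\<exists>q\<in>pl m. \<exists>\<rho>\<in>pl a. \<sigma> = \<eta> * q + [:- z, 1:] ^ m * \<rho>"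
proof -
  obtain q \<rho> where q: "q \<in> pl m" and eq: "\<sigma> = \<eta> * q + [:- z, 1:] ^ m * \<rho>"
    using division_at_point[OF z] by blast
  have "\<eta> * q \<in> pl (m + a)"
    using \<eta> q \<open>s \<le> a\<close> by (intro pl_mult) auto
  with \<sigma> have "[:- z, 1:] ^ m * \<rho> \<in> pl (m + a)"
    using eq pl_diff by (metis add_diff_cancel_left')
  then have "\<rho> \<in> pl a"
    by (rule pl_cancel_power)
  with q eq show ?thesis by blast
qed

section \<open>Linear functionals and their annihilators\<close>

definition lin :: "('k::field poly \<Rightarrow> 'k) \<Rightarrow> bool" where
  "lin \<phi> \<longleftrightarrow> (\<forall>s t. \<phi> (s + t) = \<phi> s + \<phi> t) \<and> (\<forall>c t. \<phi> (smult c t) = c * \<phi> t)"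

lemma lin_add: "lin \<phi> \<Longrightarrow> \<phi> (s + t) = \<phi> s + \<phi> t"
  and lin_smult: "lin \<phi> \<Longrightarrow> \<phi> (smult c t) = c * \<phi> t"
  by (simp_all add: lin_def)

lemma lin_zero: "lin \<phi> \<Longrightarrow> \<phi> 0 = 0"
  using lin_smult[of \<phi> 0 0] by simp

lemma lin_minus: "lin \<phi> \<Longrightarrow> \<phi> (- t) = - \<phi> t"
  using lin_smult[of \<phi> "-1" t] by simp

lemma lin_diff: "lin \<phi> \<Longrightarrow> \<phi> (s - t) = \<phi> s - \<phi> t"
  using lin_add[of \<phi> s "- t"] by (simp add: lin_minus)

lemma lin_sum: "lin \<phi> \<Longrightarrow> \<phi> (\<Sum>a\<in>A. t a) = (\<Sum>a\<in>A. \<phi> (t a))"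
  by (induction A rule: infinite_finite_induct) (simp_all add: lin_zero lin_add)

lemma lin_mult: "lin \<phi> \<Longrightarrow> lin (\<lambda>w. \<phi> (t * w))"
  by (simp add: lin_def algebra_simps)

lemma lin_comb: "lin \<phi> \<Longrightarrow> lin \<psi> \<Longrightarrow> lin (\<lambda>w. \<phi> w - c * \<psi> w)"
  by (simp add: lin_def algebra_simps)

text \<open>Functionals on \<open>pl (N + 1)\<close> model binary forms of degree \<open>N\<close> (in divided powers), and
  elements of \<open>pl (k + 1)\<close> model operators of order \<open>k\<close>, dehomogenised at \<open>V = 1\<close>. With
  functionals on \<open>pl N\<close>, the set below is the degree \<open>k\<close> part of the annihilator of forms of
  degree \<open>N - 1\<close>; for \<open>k \<ge> N\<close> it is everything, because \<open>pl 0\<close> contains \<open>0\<close> only.\<close>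

definition annih :: "('k::field poly \<Rightarrow> 'k) set \<Rightarrow> nat \<Rightarrow> nat \<Rightarrow> 'k poly set" where
  "annih \<Omega> N k = {t \<in> pl (Suc k). \<forall>\<phi>\<in>\<Omega>. \<forall>w\<in>pl (N - k). \<phi> (t * w) = 0}"

lemma annihD: "t \<in> annih \<Omega> N k \<Longrightarrow> \<phi> \<in> \<Omega> \<Longrightarrow> w \<in> pl (N - k) \<Longrightarrow> \<phi> (t * w) = 0"
  and annih_pl: "t \<in> annih \<Omega> N k \<Longrightarrow> t \<in> pl (Suc k)"
  by (simp_all add: annih_def)

text \<open>This is the ideal property: the factor \<open>q\<close> is moved into the test
  polynomial.\<close>

lemma annih_mult:
  assumes "t \<in> annih \<Omega> N k" "q \<in> pl (Suc m)"
  shows "t * q \<in> annih \<Omega> N (k + m)"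
proof -
  have "\<phi> (t * q * w) = 0" if "\<phi> \<in> \<Omega>" "w \<in> pl (N - (k + m))" for \<phi> w
  \<comment> \<open>Once \<open>k + m\<close> reaches \<open>N\<close>, truncated subtraction leaves
    \<open>0\<close> as the only test polynomial.\<close>
  proof (cases "N \<le> k + m")
    case True
    with that have "w = 0"
      by (simp add: pl_zero_iff)
    then show ?thesis
      using annihD[OF assms(1) that(1) pl_0] by simp
  next
    case False
    then have "q * w \<in> pl (N - k)"
      using assms(2) that by (intro pl_mult) auto
    then show ?thesis
      using annihD[OF assms(1) that(1)] by (simp add: mult.assoc)
  qed
  moreover have "t * q \<in> pl (Suc (k + m))"
    using assms annih_pl by (intro pl_mult) auto
  ultimately show ?thesis by (simp add: annih_def)
qed

lemma annih_mono: "t \<in> annih \<Omega> N k \<Longrightarrow> k \<le> m \<Longrightarrow> t \<in> annih \<Omega> N m"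
  for t :: "'k::field poly"
  using annih_mult[of t \<Omega> N k 1 "m - k"] pl_const[of "Suc (m - k)" "1::'k"] by (simp add: pCons_one)

lemma annih_diff:
  assumes "\<And>\<phi>. \<phi> \<in> \<Omega> \<Longrightarrow> lin \<phi>" "s \<in> annih \<Omega> N k" "t \<in> annih \<Omega> N k"
  shows "s - t \<in> annih \<Omega> N k"
  using assms by (auto simp: annih_def pl_diff left_diff_distrib lin_diff)

text \<open>Division at \<open>z\<close> writes a test polynomial as
  \<open>\<eta> * q + (X - z)^m * w'\<close>. The first part is killed through
  \<open>\<eta>\<close>, the second by the assumption on \<open>(X - z)^m * \<rho>\<close>; the
  bound on \<open>N\<close> makes the division respect degrees.\<close>

lemma annih_cancel:
  assumes lin: "\<And>\<phi>. \<phi> \<in> \<Omega> \<Longrightarrow> lin \<phi>"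
    and \<eta>: "\<eta> \<in> annih \<Omega> N s" "poly \<eta> z \<noteq> 0"
    and \<rho>: "\<rho> \<in> pl (Suc k)" "[:- z, 1:] ^ m * \<rho> \<in> annih \<Omega> N (k + m)"
    and le: "k + m + s \<le> N"
  shows "\<rho> \<in> annih \<Omega> N k"
proof -
  have "\<phi> (\<rho> * w) = 0" if \<phi>: "\<phi> \<in> \<Omega>" and w: "w \<in> pl (N - k)" for \<phi> w
  proof -
    define b where "b = N - k - m"
    have "w \<in> pl (m + b)"
      using w le by (simp add: b_def)
    moreover have "s \<le> b"
      using le by (simp add: b_def)
    ultimately obtain q w' where q: "q \<in> pl m" and w': "w' \<in> pl b"
      and eq: "w = \<eta> * q + [:- z, 1:] ^ m * w'"
      using division_at_point_bounded[OF \<eta>(2) annih_pl[OF \<eta>(1)], of w m b] by blast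
    have "\<rho> * q \<in> pl (N - s)"
      using \<rho>(1) q le by (cases "q = 0") (auto intro!: pl_mult)
    then have "\<phi> (\<eta> * (\<rho> * q)) = 0"
      using annihD[OF \<eta>(1) \<phi>] by blast
    moreover have "\<phi> ([:- z, 1:] ^ m * \<rho> * w') = 0"
      using annihD[OF \<rho>(2) \<phi>] w' by (simp add: b_def)
    ultimately show ?thesis
      unfolding eq by (simp add: distrib_left lin_add[OF lin[OF \<phi>]] mult_ac)
  qed
  with \<rho>(1) show ?thesis by (simp add: annih_def)
qed

lemma annih_cancel_linear:
  assumes lin: "\<And>\<phi>. \<phi> \<in> \<Omega> \<Longrightarrow> lin \<phi>"
    and "\<eta> \<in> annih \<Omega> N s" "poly \<eta> z \<noteq> 0"
    and "\<rho> \<in> pl (Suc k)" "[:- z, 1:] * \<rho> \<in> annih \<Omega> N (Suc k)" "k + s < N"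
  shows "\<rho> \<in> annih \<Omega> N k"
  using annih_cancel[OF lin assms(2-4), of 1] assms(5,6)
  by simp

text \<open>Dividing \<open>\<sigma>\<close> by \<open>\<eta>\<close> at \<open>z\<close> leaves a
  power of \<open>X - z\<close> times some \<open>\<rho>\<close> of degree below \<open>s\<close>.
  Cancelling the power by \<open>annih_cancel\<close> puts \<open>\<rho>\<close> into the
  annihilator, where minimality of \<open>s\<close> forces \<open>\<rho> = 0\<close>.\<close>

lemma annih_principal:
  assumes lin: "\<And>\<phi>. \<phi> \<in> \<Omega> \<Longrightarrow> lin \<phi>"
    and \<eta>: "\<eta> \<in> annih \<Omega> N s" "poly \<eta> z \<noteq> 0"
    and min: "\<And>k. k < s \<Longrightarrow> annih \<Omega> N k \<subseteq> {0}"
    and \<sigma>: "\<sigma> \<in> annih \<Omega> N r" and le: "r + s \<le> N"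
  shows "\<exists>q\<in>pl (Suc r - s). \<sigma> = \<eta> * q"
proof (cases "r < s")
  case True
  with min \<sigma> have "\<sigma> = 0" by blast
  then show ?thesis by (intro bexI[of _ 0]) auto
next
  case False
  define m where "m = Suc r - s"
  have "\<sigma> \<in> pl (m + s)"
    using False annih_pl[OF \<sigma>] by (simp add: m_def)
  then obtain q \<rho> where q: "q \<in> pl m" and \<rho>: "\<rho> \<in> pl s"
    and eq: "\<sigma> = \<eta> * q + [:- z, 1:] ^ m * \<rho>"
    using division_at_point_bounded[OF \<eta>(2) annih_pl[OF \<eta>(1)], of \<sigma> m s] by auto
  have "\<rho> = 0"
  proof (cases s)
    case 0
    with \<rho> show ?thesis by (simp add: pl_zero_iff)
  next
    case (Suc k)
    then have km: "k + m = r"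
      using False by (simp add: m_def)
    have "\<eta> * q \<in> annih \<Omega> N r"
      using annih_mult[OF \<eta>(1), of q "r - s"] q False by (simp add: m_def Suc_diff_le)
    then have "\<sigma> - \<eta> * q \<in> annih \<Omega> N r"
      using \<sigma> lin by (intro annih_diff) auto
    then have "[:- z, 1:] ^ m * \<rho> \<in> annih \<Omega> N r"
      by (simp add: eq)
    then have "\<rho> \<in> annih \<Omega> N k"
      using annih_cancel[OF lin \<eta>, of \<rho> k m] \<rho> Suc le km by simp
    then show ?thesis using min[of k] Suc by auto
  qed
  with q eq show ?thesis by (auto simp: m_def)
qed

text \<open>The combinations of the \<open>\<phi>\<^sub>j\<close> annihilated by \<open>\<theta>\<close> make up a hyperplane, which is nonzero as
  there are two independent functionals. A minimal operator \<open>\<eta>'\<close> killing it has positive degree and divides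
  \<open>\<eta>\<close> and \<open>\<theta>\<close>, and dividing by it leads back to the range of degrees of \<open>annih_cancel\<close>.\<close>

lemma annih_critical:
  fixes \<phi> :: "nat \<Rightarrow> 'k::field poly \<Rightarrow> 'k"
  assumes lin: "\<And>j. j \<le> n \<Longrightarrow> lin (\<phi> j)"
    and indep: "\<And>c. (\<And>w. w \<in> pl N \<Longrightarrow> (\<Sum>j\<le>n. c j * \<phi> j w) = 0) \<Longrightarrow> \<forall>j\<le>n. c j = 0"
    and n: "1 \<le> n"
    and \<eta>: "\<eta> \<in> annih (\<phi> ` {..n}) N s" "poly \<eta> z \<noteq> 0"
    and \<theta>: "\<theta> \<in> pl s" "[:- z, 1:] * \<theta> \<in> annih (\<phi> ` {..n}) N s"
    and N: "Suc N = 2 * s" and min: "annih (\<phi> ` {..n}) N (s - 1) \<subseteq> {0}"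
  shows "\<theta> = 0"
proof (rule ccontr)
  assume "\<theta> \<noteq> 0"
  obtain s1 where s1: "s = Suc s1" using N by (cases s) auto
  \<comment> \<open>Split \<open>w\<close> into the constant \<open>w(z)\<close> and a multiple of
    \<open>X - z\<close>; the latter times \<open>\<theta>\<close> is killed by assumption.\<close>
  have eval: "\<phi> j (\<theta> * w) = poly w z * \<phi> j \<theta>" if j: "j \<le> n" and w: "w \<in> pl s" for j w
  proof -
    obtain w' where w': "w - [:poly w z:] = [:- z, 1:] * w'"
      by (rule dvdE[OF iffD1[OF poly_eq_0_iff_dvd, of "w - [:poly w z:]" z]]) auto
    then have "[:- z, 1:] ^ 1 * w' \<in> pl (1 + s1)"
      using w by (auto simp: s1 simp flip: w' intro: pl_diff pl_const)
    then have w'pl: "w' \<in> pl s1"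
      by (rule pl_cancel_power)
    have "w = smult (poly w z) 1 + [:- z, 1:] * w'"
      using w' by (metis add.commute diff_add_cancel one_pCons smult_pCons smult_0_right mult.right_neutral)
    then have "\<theta> * w = \<theta> * (smult (poly w z) 1 + [:- z, 1:] * w')"
      by (rule arg_cong)
    also have "\<dots> = smult (poly w z) \<theta> + [:- z, 1:] * \<theta> * w'"
      by (simp add: distrib_left mult_ac del: smult_one)
    finally have "\<theta> * w = smult (poly w z) \<theta> + [:- z, 1:] * \<theta> * w'" .
    moreover have "\<phi> j ([:- z, 1:] * \<theta> * w') = 0"
      using annihD[OF \<theta>(2), of "\<phi> j" w'] j w'pl N s1 by simp
    ultimately show ?thesis
      by (simp add: lin_add[OF lin[OF j]] lin_smult[OF lin[OF j]])
  qed
  have "\<theta> \<notin> annih (\<phi> ` {..n}) N s1"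
    using min \<open>\<theta> \<noteq> 0\<close> s1 by auto
  then obtain j0 where j0: "j0 \<le> n" "\<phi> j0 \<theta> \<noteq> 0"
    using eval \<theta>(1) N s1 by (fastforce simp: annih_def)
  \<comment> \<open>The correction makes \<open>\<psi> j\<close> vanish at \<open>\<theta>\<close>,
    hence by \<open>eval\<close> at every \<open>\<theta> * w\<close> with \<open>w\<close> in
    \<open>pl s\<close>.\<close>
  define \<psi> where "\<psi> j w = \<phi> j w - \<phi> j \<theta> / \<phi> j0 \<theta> * \<phi> j0 w" for j w
  define \<Psi> where "\<Psi> = \<psi> ` {..n}"
  have lin\<psi>: "lin \<beta>" if "\<beta> \<in> \<Psi>" for \<beta>
    using that lin j0 unfolding \<Psi>_def \<psi>_def by (auto intro!: lin_comb simp del: times_divide_eq_left)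
  have \<eta>\<Psi>: "\<eta> \<in> annih \<Psi> N s"
    using \<eta>(1) j0 by (auto simp: annih_def \<Psi>_def \<psi>_def)
  have \<theta>\<Psi>: "\<theta> \<in> annih \<Psi> N s1"
    using \<theta>(1) eval j0 N s1 by (auto simp: annih_def \<Psi>_def \<psi>_def)
  define s' where "s' = (LEAST k. \<not> annih \<Psi> N k \<subseteq> {0})"
  have nz: "\<not> annih \<Psi> N s1 \<subseteq> {0}" using \<theta>\<Psi> \<open>\<theta> \<noteq> 0\<close> by auto
  have s's1: "s' \<le> s1" unfolding s'_def using nz by (rule Least_le)
  have mins': "annih \<Psi> N k \<subseteq> {0}" if "k < s'" for k
    using not_less_Least[of k "\<lambda>k. \<not> annih \<Psi> N k \<subseteq> {0}"] that unfolding s'_def by blast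
  have "\<not> annih \<Psi> N s' \<subseteq> {0}" unfolding s'_def using nz by (rule LeastI)
  then obtain \<eta>' where \<eta>': "\<eta>' \<in> annih \<Psi> N s'" "\<eta>' \<noteq> 0" by auto
  \<comment> \<open>Otherwise a nonzero constant kills all \<open>\<psi> j\<close>. For an index
    \<open>j1\<close> other than \<open>j0\<close>, this is a nontrivial relation between
    \<open>\<phi> j1\<close> and \<open>\<phi> j0\<close>.\<close>
  have "s' \<noteq> 0"
  proof
    assume "s' = 0"
    then obtain c where c: "\<eta>' = [:c:]" "c \<noteq> 0"
      using \<eta>' by (auto simp: annih_def pl_iff_degree elim: degree_eq_zeroE)
    obtain j1 where j1: "j1 \<le> n" "j1 \<noteq> j0" using n
      by (metis le_refl le0 not_one_le_zero)
    have "\<psi> j1 w = 0" if "w \<in> pl N" for w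
    proof -
      have "\<psi> j1 (\<eta>' * w) = 0"
        using annihD[OF \<eta>'(1), of "\<psi> j1" w] that \<open>s' = 0\<close> j1 by (auto simp: \<Psi>_def)
      moreover have "lin (\<psi> j1)" using lin\<psi> j1 by (auto simp: \<Psi>_def)
      ultimately show ?thesis using c by (simp add: lin_smult mult_pCons_left)
    qed
    moreover have "(\<Sum>j\<le>n. (if j = j1 then 1 else if j = j0 then - \<phi> j1 \<theta> / \<phi> j0 \<theta> else 0) * \<phi> j w) = \<psi> j1 w" for w
    proof -
      have "(\<Sum>j\<le>n. (if j = j1 then 1 else if j = j0 then - \<phi> j1 \<theta> / \<phi> j0 \<theta> else 0) * \<phi> j w)
        = (\<Sum>j\<le>n. (if j = j1 then \<phi> j w else 0) + (if j = j0 then - \<phi> j1 \<theta> / \<phi> j0 \<theta> * \<phi> j w else 0))"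
        using j1 by (intro sum.cong) auto
      also have "\<dots> = \<psi> j1 w"
        using j1 j0 by (simp add: sum.distrib \<psi>_def)
      finally show ?thesis .
    qed
    ultimately show False
      using indep[of "\<lambda>j. if j = j1 then 1 else if j = j0 then - \<phi> j1 \<theta> / \<phi> j0 \<theta> else 0"] j1 by auto
  qed
  have \<eta>'z: "poly \<eta>' z \<noteq> 0"
  proof
    assume "poly \<eta>' z = 0"
    then obtain \<kappa> where \<kappa>: "\<eta>' = [:- z, 1:] * \<kappa>" by (metis poly_eq_0_iff_dvd dvdE)
    have "[:- z, 1:] ^ 1 * \<kappa> \<in> pl (1 + s')"
      using annih_pl[OF \<eta>'(1)] by (simp add: \<kappa>)
    then have "\<kappa> \<in> pl s'" by (rule pl_cancel_power)
    then have "\<kappa> \<in> annih \<Psi> N (s' - 1)"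
      using annih_cancel_linear[OF lin\<psi> \<eta>\<Psi> \<eta>(2), of \<kappa> "s' - 1"] \<eta>'(1) \<open>s' \<noteq> 0\<close> s's1 s1 N
      by (simp flip: \<kappa>)
    with mins'[of "s' - 1"] \<open>s' \<noteq> 0\<close> \<kappa> \<eta>' show False by auto
  qed
  obtain \<kappa> where \<kappa>: "\<kappa> \<in> pl (Suc s - s')" "\<eta> = \<eta>' * \<kappa>"
    using annih_principal[OF lin\<psi> \<eta>'(1) \<eta>'z mins' \<eta>\<Psi>] s's1 s1 N by auto
  obtain \<mu> where \<mu>: "\<mu> \<in> pl (s - s')" "\<theta> = \<eta>' * \<mu>"
    using annih_principal[OF lin\<psi> \<eta>'(1) \<eta>'z mins' \<theta>\<Psi>] s's1 s1 N by auto
  \<comment> \<open>Passing to \<open>\<phi> j0\<close> after multiplication by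
    \<open>\<eta>'\<close> lowers \<open>N\<close> and the degrees of \<open>\<eta>\<close> and
    \<open>\<theta>\<close> by \<open>s'\<close> each. Since \<open>s' > 0\<close>, this gains the
    strict inequality needed to cancel \<open>X - z\<close>.\<close>
  define \<pi> where "\<pi> w = \<phi> j0 (\<eta>' * w)" for w
  have lin\<pi>: "lin \<beta>" if "\<beta> \<in> {\<pi>}" for \<beta>
    using that lin_mult[OF lin[OF j0(1)], of \<eta>'] by (simp add: \<pi>_def[abs_def])
  have "\<mu> \<in> annih {\<pi>} (N - s') (s1 - s')"
  proof (rule annih_cancel_linear[OF lin\<pi>])
    show "\<kappa> \<in> annih {\<pi>} (N - s') (s - s')"
      using annihD[OF \<eta>(1), of "\<phi> j0"] j0 s's1 s1 \<kappa> by (auto simp: annih_def \<pi>_def Suc_diff_le mult.assoc)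
    show "poly \<kappa> z \<noteq> 0" using \<eta>(2) \<kappa> by auto
    show "\<mu> \<in> pl (Suc (s1 - s'))" using \<mu> s1 s's1 by (simp add: Suc_diff_le)
    have "[:- z, 1:] * \<mu> \<in> pl (Suc (Suc (s1 - s')))"
      using \<mu> s1 s's1 by (intro pl_mult[of _ 2 _ "s - s'"]) (auto simp: pl_iff_degree)
    moreover have "\<phi> j0 (\<eta>' * ([:- z, 1:] * \<mu> * w)) = 0" if "w \<in> pl (N - s' - Suc (s1 - s'))" for w
      using annihD[OF \<theta>(2), of "\<phi> j0" w] j0 that s1 s's1 \<mu>
      by (simp add: mult_ac)
    ultimately show "[:- z, 1:] * \<mu> \<in> annih {\<pi>} (N - s') (Suc (s1 - s'))"
      by (simp add: annih_def \<pi>_def)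
    show "s1 - s' + (s - s') < N - s'" using s1 s's1 N \<open>s' \<noteq> 0\<close> by auto
  qed simp
  \<comment> \<open>Testing \<open>\<mu>\<close> against \<open>1\<close> gives
    \<open>\<phi> j0 \<theta> = 0\<close>, against the choice of \<open>j0\<close>.\<close>
  then have "\<phi> j0 (\<eta>' * (\<mu> * 1)) = 0"
    using annihD[of \<mu> "{\<pi>}" "N - s'" "s1 - s'" \<pi> 1] N s1 s's1 pl_const[of "N - s' - (s1 - s')" 1]
    by (simp add: \<pi>_def one_pCons)
  with j0 \<mu> show False by simp
qed

text \<open>A functional vanishing on a common kernel is a combination, by induction on the number
  of functionals. It replaces dimension counts for spaces of polynomials and of operators alike; the
  expression \<open>u - scale c w\<close> packs closure and linearity into one condition
  each.\<close>

lemma functional_in_span: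
  fixes x :: "'a \<Rightarrow> 'w::ab_group_add \<Rightarrow> 'k::field" and scale :: "'k \<Rightarrow> 'w \<Rightarrow> 'w"
  assumes "finite A"
    and W: "\<And>u w c. u \<in> W \<Longrightarrow> w \<in> W \<Longrightarrow> u - scale c w \<in> W"
    and x: "\<And>a u w c. a \<in> A \<Longrightarrow> u \<in> W \<Longrightarrow> w \<in> W \<Longrightarrow> x a (u - scale c w) = x a u - c * x a w"
    and v: "\<And>u w c. u \<in> W \<Longrightarrow> w \<in> W \<Longrightarrow> v (u - scale c w) = v u - c * v w"
    and ker: "\<And>w. w \<in> W \<Longrightarrow> (\<And>a. a \<in> A \<Longrightarrow> x a w = 0) \<Longrightarrow> v w = 0"
  shows "\<exists>c. \<forall>w\<in>W. v w = (\<Sum>a\<in>A. c a * x a w)"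
  using assms(1) x v ker
proof (induction A arbitrary: v rule: finite_induct)
  case empty
  then show ?case by auto
next
  case (insert b A)
  note x = insert.prems(1) and v = insert.prems(2) and ker = insert.prems(3)
  show ?case
  proof (cases "\<exists>w0\<in>W. (\<forall>a\<in>A. x a w0 = 0) \<and> x b w0 \<noteq> 0")
    case True
    then obtain w0 where w0: "w0 \<in> W" "\<And>a. a \<in> A \<Longrightarrow> x a w0 = 0" "x b w0 \<noteq> 0" by blast
    \<comment> \<open>This coefficient is forced by evaluating at \<open>w0\<close>, where the other
      functionals vanish.\<close>
    define e where "e = v w0 / x b w0"
    have "\<exists>c. \<forall>w\<in>W. v w - e * x b w = (\<Sum>a\<in>A. c a * x a w)"
    proof (rule insert.IH)
      show "v (u - scale c w) - e * x b (u - scale c w) = v u - e * x b u - c * (v w - e * x b w)"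
        if "u \<in> W" "w \<in> W" for u w c
        using that by (simp add: v x algebra_simps)
      show "v w - e * x b w = 0" if w: "w \<in> W" and "\<And>a. a \<in> A \<Longrightarrow> x a w = 0" for w
      proof -
        let ?w = "w - scale (x b w / x b w0) w0"
        have "v ?w = 0"
        proof (rule ker)
          show "?w \<in> W" by (rule W[OF w w0(1)])
          show "x a ?w = 0" if "a \<in> insert b A" for a
            using that w w0 \<open>\<And>a. a \<in> A \<Longrightarrow> x a w = 0\<close> by (auto simp: x)
        qed
        then show ?thesis using v[OF w w0(1)] w0(3) by (simp add: e_def)
      qed
    qed (use x in auto)
    then obtain c where c: "\<And>w. w \<in> W \<Longrightarrow> v w - e * x b w = (\<Sum>a\<in>A. c a * x a w)" by blast
    have "v w = (\<Sum>a\<in>insert b A. (c(b := e)) a * x a w)" if "w \<in> W" for w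
    proof -
      have "(\<Sum>a\<in>A. (c(b := e)) a * x a w) = (\<Sum>a\<in>A. c a * x a w)"
        using insert.hyps by (intro sum.cong) auto
      then show ?thesis using c[OF that] insert.hyps by (simp add: algebra_simps)
    qed
    then show ?thesis by blast
  next
    case False
    have "\<exists>c. \<forall>w\<in>W. v w = (\<Sum>a\<in>A. c a * x a w)"
    proof (rule insert.IH)
      show "v w = 0" if w: "w \<in> W" and "\<And>a. a \<in> A \<Longrightarrow> x a w = 0" for w
        using that False by (intro ker) auto
    qed (use x v in auto)
    then obtain c where c: "\<And>w. w \<in> W \<Longrightarrow> v w = (\<Sum>a\<in>A. c a * x a w)" by blast
    have "v w = (\<Sum>a\<in>insert b A. (c(b := 0)) a * x a w)" if "w \<in> W" for w
    proof -
      have "(\<Sum>a\<in>A. (c(b := 0)) a * x a w) = (\<Sum>a\<in>A. c a * x a w)"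
        using insert.hyps by (intro sum.cong) auto
      then show ?thesis using c[OF that] insert.hyps by simp
    qed
    then show ?thesis by blast
  qed
qed

section \<open>Differentiation in divided power coordinates\<close>

abbreviation "lookup \<equiv> Poly_Mapping.lookup"
abbreviation "single \<equiv> Poly_Mapping.single"
abbreviation "keys \<equiv> Poly_Mapping.keys"

text \<open>The linear functional with prescribed moments: \<open>X^a\<close> goes to
  \<open>c a\<close>.\<close>

definition fnl :: "(nat \<Rightarrow> 'k::field) \<Rightarrow> 'k poly \<Rightarrow> 'k" where
  "fnl c t = (\<Sum>a\<le>degree t. coeff t a * c a)"

lemma fnl_superset: "degree t \<le> N \<Longrightarrow> fnl c t = (\<Sum>a\<le>N. coeff t a * c a)"
  unfolding fnl_def by (rule sum.mono_neutral_left) (auto simp: coeff_eq_0)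

lemma lin_fnl: "lin (fnl c)"
proof -
  have "fnl c (s + t) = fnl c s + fnl c t" for s t
  proof -
    have "degree (s + t) \<le> max (degree s) (degree t)"
      by (rule degree_add_le_max)
    then show ?thesis
      by (simp add: fnl_superset[of _ "max (degree s) (degree t)"] distrib_right sum.distrib)
  qed
  moreover have "fnl c (smult x t) = x * fnl c t" for x t
    using degree_smult_le[of x t]
    by (simp add: fnl_superset[of _ "degree t"] sum_distrib_left mult.assoc)
  ultimately show ?thesis by (simp add: lin_def)
qed

lemma fnl_monom: "fnl c (monom x a) = x * c a"
proof -
  have "fnl c (monom x a) = (\<Sum>i\<le>a. coeff (monom x a) i * c i)"
    by (rule fnl_superset) (rule degree_monom_le)
  also have "\<dots> = (\<Sum>i\<le>a. if i = a then x * c i else 0)"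
    by (intro sum.cong) auto
  also have "\<dots> = x * c a"
    by simp
  finally show ?thesis .
qed

lemma tdeg_superset: "finite A \<Longrightarrow> keys m \<subseteq> A \<Longrightarrow> tdeg m = (\<Sum>j\<in>A. lookup m j)"
  unfolding tdeg_def by (rule sum.mono_neutral_left) (auto simp: in_keys_iff)

lemma keys_add_nat: "keys (m + m') = keys m \<union> keys m'"
  for m m' :: "'a \<Rightarrow>\<^sub>0 nat"
  by (auto simp: in_keys_iff lookup_add)

lemma tdeg_add: "tdeg (m + m') = tdeg m + tdeg m'"
  by (simp add: tdeg_superset[of "keys m \<union> keys m'"] keys_add_nat lookup_add sum.distrib)

lemma tdeg_single: "tdeg (single j a) = a"
  by (simp add: tdeg_def)

text \<open>The multi-index factorial. It absorbs the integer factors produced by differentiation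
  and is invertible in characteristic zero.\<close>

definition mfact :: "(nat \<Rightarrow>\<^sub>0 nat) \<Rightarrow> 'k::field_char_0" where
  "mfact m = (\<Prod>j\<in>keys m. fact (lookup m j))"

lemma mfact_superset: "finite A \<Longrightarrow> keys m \<subseteq> A \<Longrightarrow> mfact m = (\<Prod>j\<in>A. fact (lookup m j))"
  unfolding mfact_def by (rule prod.mono_neutral_left) (auto simp: in_keys_iff)

lemma mfact_nonzero: "mfact m \<noteq> 0"
  by (simp add: mfact_def)

lemma mfact_add_single: "mfact (k + single j 1) = of_nat (Suc (lookup k j)) * mfact k"
proof -
  let ?A = "insert j (keys k)"
  have "mfact (k + single j 1) = (\<Prod>i\<in>?A. fact (lookup (k + single j 1) i))"
    by (rule mfact_superset) (auto simp: keys_add_nat)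
  also have "\<dots> = fact (Suc (lookup k j)) * (\<Prod>i\<in>?A - {j}. fact (lookup (k + single j 1) i))"
    by (subst prod.remove[of _ j]) (auto simp: lookup_add)
  also have "(\<Prod>i\<in>?A - {j}. fact (lookup (k + single j 1) i)) = (\<Prod>i\<in>?A - {j}. fact (lookup k i))"
    by (intro prod.cong) (auto simp: lookup_add lookup_single)
  also have "fact (Suc (lookup k j)) * \<dots>
    = of_nat (Suc (lookup k j)) * (fact (lookup k j) * (\<Prod>i\<in>?A - {j}. fact (lookup k i)))"
    by (simp only: fact_Suc mult.assoc)
  also have "fact (lookup k j) * (\<Prod>i\<in>?A - {j}. fact (lookup k i)) = mfact k"
    by (subst mfact_superset[of ?A]) (auto simp: prod.remove[of ?A j])
  finally show ?thesis .
qed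

text \<open>In these coordinates, differentiation is a mere shift of coefficients.\<close>

definition dpc :: "'k::field_char_0 mpoly \<Rightarrow> (nat \<Rightarrow>\<^sub>0 nat) \<Rightarrow> 'k" where
  "dpc P k = mfact k * lookup P k"

lemma dpc_eq_iff: "P = Q \<longleftrightarrow> (\<forall>k. dpc P k = dpc Q k)"
  by (auto simp: dpc_def mfact_nonzero intro!: poly_mapping_eqI)

lemma dpc_0: "dpc 0 k = 0"
  and dpc_add: "dpc (P + Q) k = dpc P k + dpc Q k"
  and dpc_sum: "dpc (\<Sum>a\<in>A. F a) k = (\<Sum>a\<in>A. dpc (F a) k)"
  by (simp_all add: dpc_def lookup_add lookup_sum distrib_left sum_distrib_left)

lemma lookup_pdiff: "lookup (pdiff j P) k = of_nat (Suc (lookup k j)) * lookup P (k + single j 1)"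
proof -
  have "(of_nat (lookup m j) * lookup P m when m - single j 1 = k)
    = (if m = k + single j 1 then of_nat (Suc (lookup k j)) * lookup P m else 0)" for m
  \<comment> \<open>Truncated subtraction fixes monomials without variable \<open>j\<close>, but
    these carry the factor \<open>0\<close>.\<close>
  proof (cases "lookup m j = 0")
    case True
    then have "m \<noteq> k + single j 1" by (auto simp: lookup_add)
    with True show ?thesis by simp
  next
    case False
    have "m - single j 1 = k \<longleftrightarrow> m = k + single j 1"
    proof
      assume *: "m - single j 1 = k"
      show "m = k + single j 1"
      proof (rule poly_mapping_eqI)
        fix i
        show "lookup m i = lookup (k + single j 1) i"
          using False by (auto simp: lookup_add lookup_minus lookup_single when_def simp flip: *)
      qed
    qed simp
    then show ?thesis by (auto simp: lookup_add when_def)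
  qed
  then have "lookup (pdiff j P) k
    = (\<Sum>m\<in>keys P. if m = k + single j 1 then of_nat (Suc (lookup k j)) * lookup P m else 0)"
    by (simp only: pdiff_def lookup_sum lookup_single)
  also have "\<dots> = of_nat (Suc (lookup k j)) * lookup P (k + single j 1)"
    by (simp add: sum.delta in_keys_iff)
  finally show ?thesis .
qed

lemma dpc_pdiff: "dpc (pdiff j P) k = dpc P (k + single j 1)"
  by (simp only: dpc_def lookup_pdiff mfact_add_single mult_ac)

lemma dpc_pdiff_funpow: "dpc ((pdiff j ^^ r) P) k = dpc P (k + single j r)"
proof (induction r arbitrary: k)
  case (Suc r)
  have "single j (Suc r) = single j 1 + single j r"
    by (simp flip: single_add)
  then show ?case
    by (simp only: funpow.simps comp_apply dpc_pdiff Suc.IH add.assoc)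
qed simp

lemma poly_mapping_sum_single: "P = (\<Sum>m\<in>keys P. single m (lookup P m))"
  by (rule poly_mapping_eqI) (auto simp: lookup_sum lookup_single when_def in_keys_iff)

lemma dpc_pdiffs: "dpc (pdiffs m P) k = dpc P (k + m)"
proof -
  have "dpc (foldr (\<lambda>j. pdiff j ^^ lookup m j) xs P) k
    = dpc P (k + (\<Sum>j\<leftarrow>xs. single j (lookup m j)))" for xs k
  proof (induction xs arbitrary: k)
    case (Cons x xs)
    show ?case by (simp only: foldr.simps comp_apply dpc_pdiff_funpow Cons.IH list.map sum_list.Cons add.assoc)
  qed simp
  moreover have "(\<Sum>j\<leftarrow>sorted_list_of_set (keys m). single j (lookup m j)) = m"
    by (subst sum_list_distinct_conv_sum_set) (auto simp flip: poly_mapping_sum_single)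
  ultimately show ?thesis
    unfolding pdiffs_def by simp
qed

lemma lookup_cst_mult: "lookup (cst c * P) k = c * lookup P k"
  by (simp add: cst_def flip: mult_map_scale_conv_mult) (simp add: Poly_Mapping.map.rep_eq when_def)

lemma dpc_cst_mult: "dpc (cst c * P) k = c * dpc P k"
  by (simp add: dpc_def lookup_cst_mult)

lemma mult_expand:
  "P * Q = (\<Sum>m\<in>keys P. \<Sum>m'\<in>keys Q. single (m + m') (lookup P m * lookup Q m'))"
  for P Q :: "'k::comm_ring_1 mpoly"
  by (subst poly_mapping_sum_single[of P], subst poly_mapping_sum_single[of Q])
    (simp add: sum_product mult_single)

section \<open>Additive extension from monomials and the apolarity pairing\<close>

text \<open>A common scheme for \<open>pairing\<close>, \<open>ev\<close> and \<open>evy\<close>;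
  \<open>h\<close> also receives the coefficient, so that values may be scalars or
  polynomials.\<close>

definition lext :: "('a \<Rightarrow> 'k \<Rightarrow> 'b) \<Rightarrow> ('a \<Rightarrow>\<^sub>0 'k::zero) \<Rightarrow> 'b::comm_monoid_add" where
  "lext h P = (\<Sum>m\<in>keys P. h m (lookup P m))"

definition additive_family :: "('a \<Rightarrow> 'k::comm_monoid_add \<Rightarrow> 'b::comm_monoid_add) \<Rightarrow> bool" where
  "additive_family h \<longleftrightarrow> (\<forall>m. h m 0 = 0 \<and> (\<forall>x y. h m (x + y) = h m x + h m y))"

lemma additive_family_times [simp]: "additive_family (\<lambda>m x. x * C m)"
  for C :: "'a \<Rightarrow> 'k::comm_ring_1"
  by (simp add: additive_family_def distrib_right)

lemma additive_family_smult [simp]: "additive_family (\<lambda>m x. smult x (C m))"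
  for C :: "'a \<Rightarrow> 'k::comm_ring_1 poly"
  by (simp add: additive_family_def smult_add_left)

context
  fixes h :: "'a \<Rightarrow> 'k::comm_monoid_add \<Rightarrow> 'b::comm_monoid_add"
  assumes h: "additive_family h"
begin

lemma lext_superset: "finite A \<Longrightarrow> keys P \<subseteq> A \<Longrightarrow> lext h P = (\<Sum>m\<in>A. h m (lookup P m))"
  unfolding lext_def using h by (intro sum.mono_neutral_left) (auto simp: in_keys_iff additive_family_def)

lemma lext_add: "lext h (P + Q) = lext h P + lext h Q"
proof -
  have "keys (P + Q) \<subseteq> keys P \<union> keys Q"
    by (rule keys_add)
  then show ?thesis
    using h by (simp add: lext_superset[of "keys P \<union> keys Q"] lookup_add sum.distrib additive_family_def)
qed

lemma lext_single: "lext h (single m x) = h m x"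
  using h by (auto simp: lext_def additive_family_def)

lemma lext_zero: "lext h 0 = 0"
  by (simp add: lext_def)

lemma lext_sum: "lext h (\<Sum>a\<in>A. P a) = (\<Sum>a\<in>A. lext h (P a))"
  by (induction A rule: infinite_finite_induct) (simp_all add: lext_zero lext_add)

end

lemma lext_mult:
  fixes h :: "(nat \<Rightarrow>\<^sub>0 nat) \<Rightarrow> 'k::comm_ring_1 \<Rightarrow> 'b::comm_monoid_add"
  assumes "additive_family h"
  shows "lext h (P * Q) = (\<Sum>m\<in>keys P. \<Sum>m'\<in>keys Q. h (m + m') (lookup P m * lookup Q m'))"
  by (simp add: mult_expand[of P Q] lext_sum[OF assms] lext_single[OF assms])

text \<open>For \<open>C = dpc f\<close> this is the constant coefficient of
  \<open>act P f\<close>.\<close>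

definition pairing :: "('a \<Rightarrow> 'k::comm_ring_1) \<Rightarrow> ('a \<Rightarrow>\<^sub>0 'k) \<Rightarrow> 'k" where
  "pairing C = lext (\<lambda>m x. x * C m)"

lemma pairing_add: "pairing C (P + Q) = pairing C P + pairing C Q"
  and pairing_sum: "pairing C (\<Sum>a\<in>A. F a) = (\<Sum>a\<in>A. pairing C (F a))"
  by (simp_all add: pairing_def lext_add lext_sum)

lemma pairing_mult: "pairing C (P * Q) = (\<Sum>m\<in>keys P. \<Sum>m'\<in>keys Q. lookup P m * lookup Q m' * C (m + m'))"
  for C :: "(nat \<Rightarrow>\<^sub>0 nat) \<Rightarrow> 'k::comm_ring_1"
  by (simp add: pairing_def lext_mult)

lemma pairing_mult_single: "pairing C (P * single k x) = (\<Sum>m\<in>keys P. lookup P m * x * C (m + k))"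
  for C :: "(nat \<Rightarrow>\<^sub>0 nat) \<Rightarrow> 'k::comm_ring_1"
  by (cases "x = 0") (simp_all add: pairing_mult, simp add: pairing_def lext_def)

lemma pairing_mult_expand: "pairing C (P * Q) = (\<Sum>k\<in>keys Q. lookup Q k * pairing C (P * single k 1))"
  for C :: "(nat \<Rightarrow>\<^sub>0 nat) \<Rightarrow> 'k::comm_ring_1"
  by (subst poly_mapping_sum_single[of Q])
    (simp add: sum_distrib_left pairing_sum pairing_mult_single sum_distrib_right mult_ac)

lemma pairing_scale: "pairing C (cst c * P) = c * pairing C P"
  for C :: "(nat \<Rightarrow>\<^sub>0 nat) \<Rightarrow> 'k::comm_ring_1"
proof (cases "c = 0")
  case True
  then show ?thesis by (simp add: cst_def pairing_def lext_def)
next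
  case False
  then show ?thesis
    unfolding cst_def pairing_mult by (simp add: pairing_def lext_def sum_distrib_left mult.assoc)
qed

lemma dpc_act: "dpc (act \<theta> f) k = pairing (dpc f) (\<theta> * single k 1)"
  by (simp add: act_def dpc_sum dpc_cst_mult dpc_pdiffs pairing_mult_single add.commute)

text \<open>Macaulay duality: all coefficients of \<open>act \<theta> f\<close> are pairings of
  \<open>f\<close> with monomial multiples of \<open>\<theta>\<close>.\<close>

lemma act_eq_0_iff: "act \<theta> f = 0 \<longleftrightarrow> (\<forall>w. pairing (dpc f) (\<theta> * w) = 0)"
proof -
  have "act \<theta> f = 0 \<longleftrightarrow> (\<forall>k. pairing (dpc f) (\<theta> * single k 1) = 0)"
    by (simp add: dpc_eq_iff dpc_0 dpc_act)
  also have "\<dots> \<longleftrightarrow> (\<forall>w. pairing (dpc f) (\<theta> * w) = 0)"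
    by (auto, subst pairing_mult_expand, simp)
  finally show ?thesis .
qed

section \<open>Homogeneous forms\<close>

lemma formsI: "(\<And>m. lookup P m \<noteq> 0 \<Longrightarrow> keys m \<subseteq> V \<and> tdeg m = k) \<Longrightarrow> P \<in> forms V k"
  by (auto simp: forms_def vars_in_def homog_def in_keys_iff)

lemma formsD: "P \<in> forms V k \<Longrightarrow> lookup P m \<noteq> 0 \<Longrightarrow> keys m \<subseteq> V \<and> tdeg m = k"
  by (auto simp: forms_def vars_in_def homog_def in_keys_iff)

lemma forms_add: "P \<in> forms V k \<Longrightarrow> Q \<in> forms V k \<Longrightarrow> P + Q \<in> forms V k"
  for P Q :: "'k::comm_monoid_add mpoly"
  using formsD[of P V k] formsD[of Q V k] by (intro formsI) (metis add_0 lookup_add)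

lemma forms_zero: "0 \<in> forms V k"
  by (rule formsI) simp

lemma forms_sum: "(\<And>a. a \<in> A \<Longrightarrow> F a \<in> forms V k) \<Longrightarrow> (\<Sum>a\<in>A. F a) \<in> forms V k"
  for F :: "'a \<Rightarrow> 'k::comm_monoid_add mpoly"
  by (induction A rule: infinite_finite_induct) (auto simp: forms_zero forms_add)

lemma forms_single: "keys m \<subseteq> V \<Longrightarrow> tdeg m = k \<Longrightarrow> single m x \<in> forms V k"
  by (rule formsI) (auto simp: lookup_single when_def split: if_splits)

lemma forms_scale: "P \<in> forms V k \<Longrightarrow> cst c * P \<in> forms V k"
  for P :: "'k::comm_ring_1 mpoly"
  using formsD[of P V k] by (intro formsI) (metis lookup_cst_mult mult_zero_right)

lemma forms_uminus: "P \<in> forms V k \<Longrightarrow> - P \<in> forms V k"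
  for P :: "'k::comm_ring_1 mpoly"
  using formsD[of P V k] by (intro formsI) auto

lemma forms_diff: "P \<in> forms V k \<Longrightarrow> Q \<in> forms V k \<Longrightarrow> P - Q \<in> forms V k"
  for P Q :: "'k::comm_ring_1 mpoly"
  using forms_add[of P V k "- Q"] forms_uminus[of Q V k] by simp

lemma forms_mult: "P \<in> forms V i \<Longrightarrow> Q \<in> forms V j \<Longrightarrow> P * Q \<in> forms V (i + j)"
  for P Q :: "'k::comm_ring_1 mpoly"
  unfolding mult_expand[of P Q]
  using formsD[of P V i] formsD[of Q V j]
  by (intro forms_sum forms_single) (auto simp: keys_add_nat tdeg_add in_keys_iff)

lemma act_eq_0_of_degree:
  fixes f \<theta> :: "'k::field_char_0 mpoly"
  assumes "f \<in> forms V d" "\<theta> \<in> forms V' i" "d < i"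
  shows "act \<theta> f = 0"
proof -
  have "dpc f (m + k) = 0" if "m \<in> keys \<theta>" for m k
    using formsD[OF assms(1), of "m + k"] formsD[OF assms(2), of m] that assms(3)
    by (auto simp: dpc_def tdeg_add in_keys_iff)
  then show ?thesis by (simp add: dpc_eq_iff dpc_0 dpc_act pairing_mult_single)
qed

text \<open>By homogeneity of \<open>f\<close> and \<open>\<theta>\<close>, monomials outside the
  complementary degree or with variables outside \<open>V\<close> pair to zero.\<close>

lemma act_eq_0_iff_forms:
  fixes f \<theta> :: "'k::field_char_0 mpoly"
  assumes f: "f \<in> forms V d" and \<theta>: "\<theta> \<in> forms V i" and "i \<le> d"
  shows "act \<theta> f = 0 \<longleftrightarrow> (\<forall>w\<in>forms V (d - i). pairing (dpc f) (\<theta> * w) = 0)"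
proof
  assume *: "\<forall>w\<in>forms V (d - i). pairing (dpc f) (\<theta> * w) = 0"
  have "pairing (dpc f) (\<theta> * single k 1) = 0" for k
  proof (cases "keys k \<subseteq> V \<and> tdeg k = d - i")
    case True
    then show ?thesis using * forms_single by blast
  next
    case False
    have "dpc f (m + k) = 0" if "m \<in> keys \<theta>" for m
      using formsD[OF f, of "m + k"] formsD[OF \<theta>, of m] that False \<open>i \<le> d\<close>
      by (auto simp: dpc_def tdeg_add in_keys_iff keys_add_nat)
    then show ?thesis by (simp add: pairing_mult_single)
  qed
  then show "act \<theta> f = 0" by (simp add: dpc_eq_iff dpc_0 dpc_act)
qed (simp add: act_eq_0_iff)

section \<open>Translation to univariate polynomials\<close>

declare One_nat_def [simp del]

lemma poly_as_sum_pl: "t \<in> pl k \<Longrightarrow> (\<Sum>a<k. monom (coeff t a) a) = t"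
  by (rule poly_eqI) (auto simp: coeff_sum pl_def not_less)

lemma lookup_Var_mult:
  "lookup (Var j * q) m = (if lookup m j = 0 then 0 else lookup q (m - single j 1))"
  for q :: "'k::comm_ring_1 mpoly"
proof -
  have *: "Var j * q = (\<Sum>m'\<in>keys q. single (single j 1 + m') (lookup q m'))"
    by (subst mult_expand) (simp add: Var_def)
  show ?thesis
  proof (cases "lookup m j = 0")
    case True
    then have "single j 1 + m' \<noteq> m" for m'
      by (auto simp: lookup_add)
    with True show ?thesis
      by (simp add: * lookup_sum lookup_single when_def)
  next
    case False
    have "single j 1 + m' = m \<longleftrightarrow> m' = m - single j 1" for m'
    proof
      assume "m' = m - single j 1"
      with False show "single j 1 + m' = m"
        by (intro poly_mapping_eqI) (auto simp: lookup_add lookup_minus lookup_single when_def)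
    qed auto
    with False show ?thesis
      by (simp add: * lookup_sum lookup_single when_def in_keys_iff)
  qed
qed

definition mon :: "nat \<Rightarrow> nat \<Rightarrow> nat \<Rightarrow> (nat \<Rightarrow>\<^sub>0 nat)" where
  "mon n a b = single (n + 1) a + single (n + 2) b"

lemma lookup_mon: "lookup (mon n a b) j = (if j = n + 1 then a else if j = n + 2 then b else 0)"
  by (auto simp: mon_def lookup_add lookup_single when_def)

lemma keys_mon: "keys (mon n a b) \<subseteq> {n + 1, n + 2}"
  by (auto simp: in_keys_iff lookup_mon split: if_splits)

lemma tdeg_mon: "tdeg (mon n a b) = a + b"
  by (simp add: mon_def tdeg_add tdeg_single)

lemma mon_eqI:
  assumes "keys m \<subseteq> {..n+2}" "\<And>j. j \<le> n \<Longrightarrow> lookup m j = 0"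
  shows "m = mon n (lookup m (n + 1)) (lookup m (n + 2))"
proof (rule poly_mapping_eqI)
  fix j
  show "lookup m j = lookup (mon n (lookup m (n + 1)) (lookup m (n + 2))) j"
    using assms(1) assms(2)[of j] by (cases "j \<le> n + 2") (auto simp: lookup_mon in_keys_iff subset_iff)
qed

lemma tdeg_mon_eq:
  assumes "keys m \<subseteq> {..n+2}" "\<And>j. j \<le> n \<Longrightarrow> lookup m j = 0" "tdeg m = k"
  shows "m = mon n (lookup m (n + 1)) (k - lookup m (n + 1))" "lookup m (n + 1) \<le> k"
  using mon_eqI[OF assms(1,2)] tdeg_mon[of n "lookup m (n + 1)" "lookup m (n + 2)"] assms(3)
  by (metis add_diff_cancel_left', metis le_add1)

text \<open>The image of a monomial under \<open>y_i = 0\<close>, \<open>U = X\<close>,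
  \<open>V = 1\<close>; \<open>hy\<close> does the same for the coefficient of \<open>y_j\<close> in
  the part linear in the \<open>y_i\<close>. In a fixed degree the exponent of \<open>V\<close> can
  be recovered.\<close>

definition hz :: "nat \<Rightarrow> (nat \<Rightarrow>\<^sub>0 nat) \<Rightarrow> 'k::comm_ring_1 poly" where
  "hz n m = (if \<forall>i\<le>n. lookup m i = 0 then monom 1 (lookup m (n + 1)) else 0)"

definition hy :: "nat \<Rightarrow> nat \<Rightarrow> (nat \<Rightarrow>\<^sub>0 nat) \<Rightarrow> 'k::comm_ring_1 poly" where
  "hy n j m = (if lookup m j = 1 \<and> (\<forall>i\<le>n. i \<noteq> j \<longrightarrow> lookup m i = 0) then monom 1 (lookup m (n + 1)) else 0)"

lemma hz_add: "hz n (m + m') = hz n m * hz n m'"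
proof -
  have "(\<forall>i\<le>n. lookup (m + m') i = 0) \<longleftrightarrow> (\<forall>i\<le>n. lookup m i = 0) \<and> (\<forall>i\<le>n. lookup m' i = 0)"
    by (auto simp: lookup_add)
  then show ?thesis
    by (simp only: hz_def) (simp add: lookup_add mult_monom)
qed

text \<open>A Leibniz rule: taking the coefficient of \<open>y_j\<close> is differentiation at
  \<open>y = 0\<close>.\<close>

lemma hy_add:
  assumes "j \<le> n"
  shows "hy n j (m + m') = hy n j m * hz n m' + hz n m * hy n j m'"
proof -
  define Z where "Z m \<longleftrightarrow> (\<forall>i\<le>n. lookup m i = 0)" for m :: "nat \<Rightarrow>\<^sub>0 nat"
  define Y where "Y m \<longleftrightarrow> lookup m j = 1 \<and> (\<forall>i\<le>n. i \<noteq> j \<longrightarrow> lookup m i = 0)" for m :: "nat \<Rightarrow>\<^sub>0 nat"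
  have split: "Y (m + m') \<longleftrightarrow> (Y m \<and> Z m') \<or> (Z m \<and> Y m')"
  proof
    assume Y: "Y (m + m')"
    have o: "lookup m i = 0" "lookup m' i = 0" if "i \<le> n" "i \<noteq> j" for i
      using Y that by (auto simp: Y_def lookup_add)
    have "lookup m j + lookup m' j = 1"
      using Y by (simp add: Y_def lookup_add)
    then consider "lookup m j = 1" "lookup m' j = 0" | "lookup m j = 0" "lookup m' j = 1"
      by linarith
    then show "(Y m \<and> Z m') \<or> (Z m \<and> Y m')"
    proof cases
      case 1
      then have "Z m'"
        using o unfolding Z_def by metis
      with 1 o show ?thesis by (simp add: Y_def)
    next
      case 2
      then have "Z m"
        using o unfolding Z_def by metis
      with 2 o show ?thesis by (simp add: Y_def)
    qed
  qed (use assms in \<open>auto simp: Y_def Z_def lookup_add\<close>)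
  have excl: "\<not> (Y m \<and> Z m)" for m
    using assms by (auto simp: Y_def Z_def)
  have hy: "hy n j m = (if Y m then monom 1 (lookup m (n + 1)) else 0)" for m
    by (simp add: hy_def Y_def)
  have hz: "hz n m = (if Z m then monom 1 (lookup m (n + 1)) else 0)" for m
    by (simp add: hz_def Z_def)
  show ?thesis
    using excl[of m] excl[of m'] by (simp add: hy hz split) (simp add: lookup_add mult_monom)
qed

lemma hz_mon: "hz n (mon n a b) = monom 1 a"
  by (simp add: hz_def lookup_mon)

lemma hy_mon: "j \<le> n \<Longrightarrow> hy n j (mon n a b) = 0"
  by (simp add: hy_def lookup_mon)

lemma hz_y_mon: "j \<le> n \<Longrightarrow> hz n (single j 1 + mon n a b) = 0"
  by (auto simp: hz_def lookup_mon lookup_add)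

lemma hy_y_mon: "j \<le> n \<Longrightarrow> i \<le> n \<Longrightarrow> hy n j (single i 1 + mon n a b) = (if i = j then monom 1 a else 0)"
  by (auto simp: hy_def lookup_mon lookup_add lookup_single when_def)

text \<open>The component free of \<open>y\<close> and the coefficient of \<open>y\<^sub>j\<close> of an operator, dehomogenised at
  \<open>U = X\<close>, \<open>V = 1\<close>; the remaining components kill a form that is linear in the \<open>x\<^sub>j\<close>.\<close>

definition ev :: "nat \<Rightarrow> 'k::comm_ring_1 mpoly \<Rightarrow> 'k poly" where
  "ev n = lext (\<lambda>m x. smult x (hz n m))"

definition evy :: "nat \<Rightarrow> nat \<Rightarrow> 'k::comm_ring_1 mpoly \<Rightarrow> 'k poly" where
  "evy n j = lext (\<lambda>m x. smult x (hy n j m))"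

lemma ev_add: "ev n (P + Q) = ev n P + ev n Q"
  and evy_add: "evy n j (P + Q) = evy n j P + evy n j Q"
  and ev_single: "ev n (single m x) = smult x (hz n m)"
  and evy_single: "evy n j (single m x) = smult x (hy n j m)"
  and ev_sum: "ev n (\<Sum>a\<in>A. F a) = (\<Sum>a\<in>A. ev n (F a))"
  and evy_sum: "evy n j (\<Sum>a\<in>A. F a) = (\<Sum>a\<in>A. evy n j (F a))"
  by (simp_all add: ev_def evy_def lext_add lext_single lext_sum)

lemma ev_mult: "ev n (P * Q) = ev n P * ev n Q"
  for P Q :: "'k::comm_ring_1 mpoly"
  unfolding ev_def lext_mult[OF additive_family_smult]
  by (simp add: hz_add lext_def sum_product mult_ac)

lemma evy_mult: "j \<le> n \<Longrightarrow> evy n j (P * Q) = evy n j P * ev n Q + ev n P * evy n j Q"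
  for P Q :: "'k::comm_ring_1 mpoly"
  unfolding ev_def evy_def lext_mult[OF additive_family_smult]
  by (simp add: hy_add lext_def sum_product smult_add_right sum.distrib mult.commute[of "lookup P _"])

lemma ev_zero: "ev n 0 = 0"
  by (simp add: ev_def lext_zero)

lemma ev_uminus: "ev n (- P) = - ev n P"
  for P :: "'k::comm_ring_1 mpoly"
  by (metis add.right_inverse ev_add ev_zero minus_unique)

lemma ev_diff: "ev n (P - Q) = ev n P - ev n Q"
  for P Q :: "'k::comm_ring_1 mpoly"
  using ev_add[of n P "- Q"] by (simp add: ev_uminus)

lemma lookup_le_tdeg: "lookup m j \<le> tdeg m"
proof (cases "j \<in> keys m")
  case True
  then show ?thesis unfolding tdeg_def by (intro member_le_sum) auto
next
  case False
  then show ?thesis by (simp add: in_keys_iff)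
qed

lemma lookup_add_le_tdeg: "i \<noteq> j \<Longrightarrow> lookup m i + lookup m j \<le> tdeg m"
proof -
  assume "i \<noteq> j"
  then have "lookup m i + lookup m j = (\<Sum>k\<in>{i, j}. lookup m k)" by simp
  also have "\<dots> \<le> (\<Sum>k\<in>keys m \<union> {i, j}. lookup m k)"
    by (rule sum_mono2) auto
  also have "\<dots> = tdeg m"
    by (rule tdeg_superset[symmetric]) auto
  finally show ?thesis .
qed

lemma ev_pl:
  fixes P :: "'k::comm_ring_1 mpoly"
  assumes "P \<in> forms V k"
  shows "ev n P \<in> pl (Suc k)"
proof -
  have "smult (lookup P m) (hz n m) \<in> pl (Suc k)" if "m \<in> keys P" for m
    using formsD[OF assms, of m] that lookup_le_tdeg[of m "n + 1"]
    by (auto simp: hz_def in_keys_iff intro!: pl_smult pl_monom)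
  then show ?thesis unfolding ev_def lext_def by (rule pl_sum)
qed

lemma evy_pl:
  fixes P :: "'k::comm_ring_1 mpoly"
  assumes "P \<in> forms V k" "j \<le> n"
  shows "evy n j P \<in> pl k"
proof -
  have "smult (lookup P m) (hy n j m) \<in> pl k" if "m \<in> keys P" for m
    using formsD[OF assms(1), of m] that lookup_add_le_tdeg[of j "n + 1" m] assms(2)
    by (auto simp: hy_def in_keys_iff intro!: pl_smult pl_monom)
  then show ?thesis unfolding evy_def lext_def by (rule pl_sum)
qed

text \<open>The components can be prescribed independently: \<open>w0\<close> is homogenised to
  degree \<open>k\<close>, and each \<open>w j\<close> to degree \<open>k - 1\<close> and multiplied
  by \<open>y_j\<close>.\<close>

lemma ev_lift:
  fixes w :: "nat \<Rightarrow> 'k::comm_ring_1 poly"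
  assumes w0: "w0 \<in> pl (Suc k)" and w: "\<And>j. j \<le> n \<Longrightarrow> w j \<in> pl k"
  shows "\<exists>P\<in>Rdeg n k. ev n P = w0 \<and> (\<forall>j\<le>n. evy n j P = w j)"
proof -
  define Q where "Q = (\<Sum>a<Suc k. single (mon n a (k - a)) (coeff w0 a))"
  \<comment> \<open>For \<open>k = 0\<close> the sum is empty, so the truncated \<open>k - 1\<close>
    does no harm.\<close>
  define L where "L i = (\<Sum>a<k. single (single i 1 + mon n a (k - 1 - a)) (coeff (w i) a))" for i
  have mon: "keys (mon n a b) \<subseteq> {..n+2}" for a b using keys_mon[of n a b] by auto
  have "Q \<in> Rdeg n k"
    unfolding Q_def using mon by (intro forms_sum forms_single) (auto simp: tdeg_mon)
  moreover have "L i \<in> Rdeg n k" if "i \<le> n" for i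
    unfolding L_def using mon that
    by (intro forms_sum forms_single) (auto simp: tdeg_mon tdeg_add tdeg_single keys_add_nat)
  ultimately have "Q + (\<Sum>i\<le>n. L i) \<in> Rdeg n k"
    by (intro forms_add forms_sum) auto
  moreover have "ev n Q = w0"
    using poly_as_sum_pl[OF w0] by (simp only: Q_def ev_sum ev_single hz_mon smult_monom mult_1_right)
  moreover have "ev n (L i) = 0" if "i \<le> n" for i
    using that by (simp add: L_def ev_sum ev_single hz_y_mon)
  moreover have "evy n j Q = 0" if "j \<le> n" for j
    by (simp only: Q_def evy_sum evy_single hy_mon[OF that] smult_0_right sum.neutral_const)
  moreover have "evy n j (L i) = (if i = j then w j else 0)" if "j \<le> n" "i \<le> n" for i j
    using poly_as_sum_pl[OF w[OF that(1)]] that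
    by (simp add: L_def evy_sum evy_single hy_y_mon smult_monom)
  ultimately show ?thesis
    by (intro bexI[of _ "Q + (\<Sum>i\<le>n. L i)"]) (auto simp: ev_add evy_add ev_sum evy_sum)
qed

lemma forms_mono: "P \<in> forms V k \<Longrightarrow> V \<subseteq> V' \<Longrightarrow> P \<in> forms V' k"
  by (auto simp: forms_def vars_in_def)

section \<open>The Perazzo form expressed through functionals\<close>

locale perazzo_setup =
  fixes n d :: nat and p :: "nat \<Rightarrow> 'k::field_char_0 mpoly" and g :: "'k mpoly"
  assumes perazzo: "perazzo n d p g" and n_pos: "1 \<le> n" and d_pos: "1 \<le> d"
begin

abbreviation "f \<equiv> perazzo_form n p g"

text \<open>\<open>phi j\<close> and \<open>gam\<close> are \<open>p j\<close> and \<open>g\<close>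
  as functionals, with natural domains \<open>pl d\<close> and \<open>pl (Suc d)\<close> since the
  degrees are \<open>d - 1\<close> and \<open>d\<close>.\<close>

definition phi :: "nat \<Rightarrow> 'k poly \<Rightarrow> 'k" where
  "phi j = fnl (\<lambda>a. dpc (p j) (mon n a (d - 1 - a)))"

definition gam :: "'k poly \<Rightarrow> 'k" where
  "gam = fnl (\<lambda>a. dpc g (mon n a (d - a)))"

lemma lin_phi: "lin (phi j)" and lin_gam: "lin gam"
  by (simp_all add: phi_def gam_def lin_fnl)

lemma p_forms: "j \<le> n \<Longrightarrow> p j \<in> forms {n+1, n+2} (d - 1)"
  and g_forms: "g \<in> forms {n+1, n+2} d"
  using perazzo by (simp_all add: perazzo_def)

lemma lookup_f: "lookup f m = (\<Sum>j\<le>n. if lookup m j = 0 then 0 else lookup (p j) (m - single j 1)) + lookup g m"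
  by (simp add: perazzo_form_def lookup_add lookup_sum lookup_Var_mult)

lemma f_forms: "f \<in> Rdeg n d"
proof -
  have "Var j * p j \<in> Rdeg n (1 + (d - 1))" if "j \<le> n" for j
  proof (rule forms_mult)
    show "Var j \<in> Rdeg n 1"
      unfolding Var_def using that by (intro forms_single) (auto simp: tdeg_single)
    show "p j \<in> Rdeg n (d - 1)"
      using p_forms[OF that] by (rule forms_mono) auto
  qed
  moreover have "g \<in> Rdeg n d"
    using g_forms by (rule forms_mono) auto
  ultimately show ?thesis
    unfolding perazzo_form_def using d_pos by (intro forms_add forms_sum) auto
qed

lemma lookup_eq_0_of_y:
  assumes "j \<le> n" "lookup m j \<noteq> 0"
  shows "i \<le> n \<Longrightarrow> lookup (p i) m = 0" "lookup g m = 0"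
proof -
  have "\<not> keys m \<subseteq> {n+1, n+2}"
    using assms by (auto simp: subset_iff in_keys_iff)
  then show "i \<le> n \<Longrightarrow> lookup (p i) m = 0" "lookup g m = 0"
    using formsD[OF p_forms, of i m] formsD[OF g_forms, of m] by blast+
qed

text \<open>As \<open>f\<close> is linear in the \<open>x_j\<close>, a monomial without them sees
  only \<open>g\<close>, one with a single \<open>x_i\<close> sees only \<open>p i\<close>, and all
  others have coefficient zero.\<close>

lemma dpc_f_eq:
  assumes m: "keys m \<subseteq> {..n+2}" "tdeg m = d"
  shows "dpc f m = gam (hz n m) + (\<Sum>j\<le>n. phi j (hy n j m))"
proof (cases "\<exists>i\<le>n. lookup m i \<noteq> 0")
  case False
  then have z: "\<And>i. i \<le> n \<Longrightarrow> lookup m i = 0" by blast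
  have "dpc f m = dpc g m"
    using z by (simp add: dpc_def lookup_f)
  moreover have "gam (hz n m) = dpc g m"
    using z tdeg_mon_eq(1)[OF m(1) z m(2)] by (simp add: hz_def gam_def fnl_monom)
  moreover have "phi j (hy n j m) = 0" if "j \<le> n" for j
    using z that by (simp add: hy_def lin_zero[OF lin_phi])
  ultimately show ?thesis by simp
next
  case True
  then obtain i where i: "i \<le> n" "lookup m i \<noteq> 0" by blast
  have gz: "lookup g m = 0" using lookup_eq_0_of_y(2)[OF i] .
  have hz: "hz n m = 0" using i by (auto simp: hz_def)
  show ?thesis
  proof (cases "lookup m i = 1 \<and> (\<forall>j\<le>n. j \<noteq> i \<longrightarrow> lookup m j = 0)")
    case True
    define m' where "m' = m - single i 1"
    have mm': "m = m' + single i 1"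
      using True by (intro poly_mapping_eqI) (auto simp: m'_def lookup_add lookup_minus lookup_single when_def)
    have z: "lookup m' j = 0" if "j \<le> n" for j
      using True that by (auto simp: m'_def lookup_minus lookup_single when_def)
    have k: "keys m' \<subseteq> {..n+2}" and t: "tdeg m' = d - 1"
      using m mm' by (auto simp: keys_add_nat tdeg_add tdeg_single)
    have "lookup m' (n + 1) = lookup m (n + 1)"
      using i by (simp add: mm' lookup_add lookup_single)
    then have m'eq: "m' = mon n (lookup m (n + 1)) (d - 1 - lookup m (n + 1))"
      using tdeg_mon_eq(1)[OF k z t] by simp
    have "lookup f m = (\<Sum>j\<le>n. if j = i then lookup (p i) m' else 0)"
      unfolding lookup_f gz add_0_right
      by (rule sum.cong) (use True i in \<open>auto simp: m'_def\<close>)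
    also have "\<dots> = lookup (p i) m'"
      using i by simp
    finally have "dpc f m = dpc (p i) m'"
      using mfact_add_single[of m' i, where 'a='k] z[of i] i by (simp add: dpc_def flip: mm')
    moreover have "(\<Sum>j\<le>n. phi j (hy n j m)) = (\<Sum>j\<le>n. if j = i then dpc (p i) m' else 0)"
      using True i m'eq
      by (intro sum.cong) (auto simp: hy_def phi_def fnl_monom lin_zero[OF lin_fnl])
    ultimately show ?thesis
      using i by (simp add: hz lin_zero[OF lin_gam])
  next
    case False
    \<comment> \<open>Removing one \<open>x_j\<close> still leaves some \<open>x_i\<close> in the
      monomial, while \<open>p j\<close> is a form in \<open>u\<close>, \<open>v\<close>.\<close>
    have "lookup (p j) (m - single j 1) = 0" if "j \<le> n" "lookup m j \<noteq> 0" for j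
    proof (cases "lookup m i = 1")
      case True
      then obtain i' where "i' \<le> n" "i' \<noteq> i" "lookup m i' \<noteq> 0" using False by blast
      then show ?thesis
        using lookup_eq_0_of_y(1)[of i "m - single j 1" j] lookup_eq_0_of_y(1)[of i' "m - single j 1" j] i that
        by (cases "j = i") (auto simp: lookup_minus lookup_single)
    next
      case False
      then show ?thesis
        using lookup_eq_0_of_y(1)[of i "m - single j 1" j] i that
        by (auto simp: lookup_minus lookup_single when_def)
    qed
    then have "lookup f m = 0"
      unfolding lookup_f gz by (auto intro!: sum.neutral)
    moreover have "phi j (hy n j m) = 0" if "j \<le> n" for j
    proof -
      have "\<not> (lookup m j = 1 \<and> (\<forall>i\<le>n. i \<noteq> j \<longrightarrow> lookup m i = 0))"
        using False i by metis
      then have "hy n j m = (0 :: 'k poly)"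
        unfolding hy_def by (rule if_not_P)
      then show ?thesis by (simp add: lin_zero[OF lin_phi])
    qed
    ultimately show ?thesis
      by (simp add: hz lin_zero[OF lin_gam] dpc_def)
  qed
qed

lemma pairing_eq:
  assumes "P \<in> Rdeg n d"
  shows "pairing (dpc f) P = gam (ev n P) + (\<Sum>j\<le>n. phi j (evy n j P))"
proof -
  have "pairing (dpc f) P = (\<Sum>m\<in>keys P. lookup P m * (gam (hz n m) + (\<Sum>j\<le>n. phi j (hy n j m))))"
    unfolding pairing_def lext_def using formsD[OF assms]
    by (intro sum.cong refl) (simp add: dpc_f_eq in_keys_iff)
  also have "\<dots> = gam (ev n P) + (\<Sum>j\<le>n. \<Sum>m\<in>keys P. lookup P m * phi j (hy n j m))"
    unfolding ev_def lext_def
    by (subst sum.swap) (simp add: lin_sum[OF lin_gam] lin_smult[OF lin_gam] distrib_left sum.distrib sum_distrib_left)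
  also have "\<dots> = gam (ev n P) + (\<Sum>j\<le>n. phi j (evy n j P))"
    unfolding evy_def lext_def by (simp add: lin_sum[OF lin_phi] lin_smult[OF lin_phi])
  finally show ?thesis .
qed

abbreviation annW :: "nat \<Rightarrow> 'k poly set" where
  "annW \<equiv> annih (phi ` {..n}) d"

text \<open>The condition coming from test operators in \<open>U\<close>, \<open>V\<close> only;
  tests linear in the \<open>y_j\<close> give the condition \<open>annW\<close>.\<close>

definition killed :: "nat \<Rightarrow> 'k poly \<Rightarrow> (nat \<Rightarrow> 'k poly) \<Rightarrow> bool" where
  "killed k t0 t \<longleftrightarrow> (\<forall>w\<in>pl (Suc (d - k)). gam (t0 * w) + (\<Sum>j\<le>n. phi j (t j * w)) = 0)"

lemma pairing_mult_eq:
  assumes "P \<in> Rdeg n i" "Q \<in> Rdeg n j" "i + j = d"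
  shows "pairing (dpc f) (P * Q) = gam (ev n P * ev n Q) + (\<Sum>j\<le>n. phi j (evy n j P * ev n Q))
    + (\<Sum>j\<le>n. phi j (ev n P * evy n j Q))"
proof -
  have "P * Q \<in> Rdeg n d" using forms_mult[OF assms(1,2)] assms(3) by simp
  then show ?thesis
    by (simp add: pairing_eq ev_mult evy_mult lin_add[OF lin_phi] sum.distrib)
qed

text \<open>By \<open>ev_lift\<close>, the \<open>y\<close>-free component and the
  \<open>y_j\<close> coefficients of a test operator vary independently, so vanishing of the pairing
  splits into two conditions.\<close>

lemma act_f_eq_0_iff:
  assumes \<theta>: "\<theta> \<in> Rdeg n i" and "i \<le> d"
  shows "act \<theta> f = 0 \<longleftrightarrow> ev n \<theta> \<in> annW i \<and> killed i (ev n \<theta>) (\<lambda>j. evy n j \<theta>)"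
proof
  assume *: "act \<theta> f = 0"
  have P: "gam (ev n \<theta> * w0) + (\<Sum>j\<le>n. phi j (evy n j \<theta> * w0)) + (\<Sum>j\<le>n. phi j (ev n \<theta> * w j)) = 0"
    if w0: "w0 \<in> pl (Suc (d - i))" and w: "\<And>j. j \<le> n \<Longrightarrow> w j \<in> pl (d - i)" for w0 w
  proof -
    obtain Q where Q: "Q \<in> Rdeg n (d - i)" "ev n Q = w0" "\<And>j. j \<le> n \<Longrightarrow> evy n j Q = w j"
      using ev_lift[OF w0, of n w] w by blast
    have "(\<Sum>j\<le>n. phi j (ev n \<theta> * w j)) = (\<Sum>j\<le>n. phi j (ev n \<theta> * evy n j Q))"
      using Q(3) by (intro sum.cong) auto
    then show ?thesis
      using * act_eq_0_iff[of \<theta> f] pairing_mult_eq[OF \<theta> Q(1)] \<open>i \<le> d\<close> Q(2) by simp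
  qed
  have "killed i (ev n \<theta>) (\<lambda>j. evy n j \<theta>)"
    unfolding killed_def using P[of _ "\<lambda>_. 0"] by (simp add: lin_zero[OF lin_phi])
  moreover have "phi j (ev n \<theta> * w) = 0" if "j \<le> n" "w \<in> pl (d - i)" for j w
  proof -
    have "(\<Sum>k\<le>n. phi k (ev n \<theta> * (if k = j then w else 0))) = (\<Sum>k\<le>n. if k = j then phi j (ev n \<theta> * w) else 0)"
      by (intro sum.cong) (auto simp: lin_zero[OF lin_phi])
    then show ?thesis
      using P[of 0 "\<lambda>k. if k = j then w else 0"] that
      by (simp add: lin_zero[OF lin_phi] lin_zero[OF lin_gam])
  qed
  ultimately show "ev n \<theta> \<in> annW i \<and> killed i (ev n \<theta>) (\<lambda>j. evy n j \<theta>)"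
    using ev_pl[OF \<theta>] by (auto simp: annih_def)
next
  assume *: "ev n \<theta> \<in> annW i \<and> killed i (ev n \<theta>) (\<lambda>j. evy n j \<theta>)"
  have "pairing (dpc f) (\<theta> * Q) = 0" if Q: "Q \<in> Rdeg n (d - i)" for Q
  proof -
    have "phi j (ev n \<theta> * evy n j Q) = 0" if "j \<le> n" for j
      using * annihD[of "ev n \<theta>" "phi ` {..n}" d i "phi j" "evy n j Q"] evy_pl[OF Q that] that by auto
    moreover have "ev n Q \<in> pl (Suc (d - i))"
      by (rule ev_pl[OF Q])
    ultimately show ?thesis
      using * \<open>i \<le> d\<close> by (simp add: pairing_mult_eq[OF \<theta> Q] killed_def)
  qed
  then show "act \<theta> f = 0"
    using act_eq_0_iff_forms[OF f_forms \<theta> \<open>i \<le> d\<close>] by blast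
qed

lemma phi_independent:
  assumes "\<And>w. w \<in> pl d \<Longrightarrow> (\<Sum>j\<le>n. c j * phi j w) = 0"
  shows "\<forall>j\<le>n. c j = 0"
proof -
  have "dpc (\<Sum>i\<le>n. mscale (c i) (p i)) m = 0" for m
  proof (cases "keys m \<subseteq> {n+1, n+2} \<and> tdeg m = d - 1")
    case True
    then have k: "keys m \<subseteq> {..n+2}" and t: "tdeg m = d - 1"
      by (auto intro: subset_trans[of "keys m" "{n+1, n+2}"])
    have z: "lookup m j = 0" if "j \<le> n" for j
      using True that by (force simp: in_keys_iff)
    define a where "a = lookup m (n + 1)"
    have m: "m = mon n a (d - 1 - a)" "a \<le> d - 1"
      using tdeg_mon_eq[OF k z t] by (auto simp: a_def)
    have "(monom 1 a :: 'k poly) \<in> pl d"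
      using m(2) d_pos by (intro pl_monom) auto
    moreover have "phi j (monom 1 a) = dpc (p j) m" for j
      by (simp only: phi_def fnl_monom m(1)[symmetric] mult_1_left)
    ultimately show ?thesis
      using assms[of "monom 1 a"] by (simp add: dpc_sum mscale_def dpc_cst_mult)
  next
    case False
    then have "lookup (p i) m = 0" if "i \<le> n" for i
      using formsD[OF p_forms[OF that], of m] by blast
    then show ?thesis by (simp add: dpc_sum mscale_def dpc_cst_mult) (simp add: dpc_def)
  qed
  then have "(\<Sum>i\<le>n. mscale (c i) (p i)) = 0"
    by (simp add: dpc_eq_iff dpc_0)
  then show ?thesis using perazzo by (simp add: perazzo_def)
qed

end

section \<open>The weak Lefschetz property\<close>

lemma poly_mult_as_sum_pl:
  assumes "lin \<phi>" "t \<in> pl k"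
  shows "\<phi> (t * w) = (\<Sum>a<k. coeff t a * \<phi> (monom 1 a * w))"
proof -
  have "t * w = (\<Sum>a<k. smult (coeff t a) (monom 1 a * w))"
    by (subst poly_as_sum_pl[OF assms(2), symmetric]) (simp add: sum_distrib_right smult_monom flip: mult_smult_left)
  then show ?thesis
    by (simp add: lin_sum[OF assms(1)] lin_smult[OF assms(1)])
qed

text \<open>Multiples of a linear form are a proper subspace of the binary forms. They are detected
  by evaluation at the root of \<open>l\<close>, or by the top coefficient if \<open>l\<close> is a
  multiple of \<open>V\<close>, the root then being at infinity.\<close>

lemma functional_killing_multiples:
  fixes l :: "'k::field poly"
  assumes "l \<in> pl 2"
  shows "\<exists>v. lin v \<and> (\<forall>t\<in>pl k. v (l * t) = 0) \<and> (\<exists>w\<in>pl (Suc k). v w \<noteq> 0)"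
proof (cases "coeff l 1 = 0")
  case True
  have "l = [:coeff l 0:]"
  proof (rule poly_eqI)
    fix a
    show "coeff l a = coeff [:coeff l 0:] a"
      using assms True by (cases "a = 0"; cases "a = 1") (auto simp: pl_def coeff_pCons split: nat.splits)
  qed
  then obtain c where "l = [:c:]" by blast
  then have "coeff (l * t) k = 0" if "t \<in> pl k" for t
    using that by (simp add: mult_pCons_left pl_def)
  then show ?thesis
    by (intro exI[of _ "\<lambda>w. coeff w k"] conjI bexI[of _ "monom 1 k"]) (auto simp: lin_def intro: pl_monom)
next
  case False
  define r where "r = - coeff l 0 / coeff l 1"
  have "degree l \<le> 1"
    using assms by (auto simp: pl_iff_degree)
  then have "poly l r = coeff l 0 + coeff l 1 * r"
    by (subst poly_altdef, subst sum.mono_neutral_left[of "{..1}"]) (auto simp: coeff_eq_0 One_nat_def)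
  then have "poly l r = 0"
    using False by (simp add: r_def)
  then show ?thesis
    by (intro exI[of _ "\<lambda>w. poly w r"] conjI bexI[of _ 1]) (auto simp: lin_def pl_iff_degree)
qed

lemma pairing_diff: "pairing C (P - Q) = pairing C P - pairing C Q"
  using pairing_add[of C "P - Q" Q] by simp

lemma cst_single_1: "single m c = cst c * single m 1"
  for c :: "'k::comm_ring_1"
  by (simp add: cst_def mult_single)

lemma finite_monomials: "finite {m. keys m \<subseteq> {..N} \<and> tdeg m = i}"
proof -
  let ?F = "\<lambda>m. map (lookup m) [0..<Suc N]"
  have "?F ` {m. keys m \<subseteq> {..N} \<and> tdeg m = i} \<subseteq> {xs. set xs \<subseteq> {..i} \<and> length xs = Suc N}"
    using lookup_le_tdeg by auto
  then have "finite (?F ` {m. keys m \<subseteq> {..N} \<and> tdeg m = i})"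
    by (rule finite_subset) (simp add: finite_lists_length_eq)
  moreover have "inj_on ?F {m. keys m \<subseteq> {..N} \<and> tdeg m = i}"
  proof (intro inj_onI poly_mapping_eqI)
    fix m m' j
    assume m: "m \<in> {m. keys m \<subseteq> {..N} \<and> tdeg m = i}" and m': "m' \<in> {m. keys m \<subseteq> {..N} \<and> tdeg m = i}"
      and eq: "?F m = ?F m'"
    show "lookup m j = lookup m' j"
    proof (cases "j \<le> N")
      case True
      then show ?thesis
        using arg_cong[OF eq, of "\<lambda>xs. xs ! j"] by (simp add: nth_map del: upt_Suc)
    next
      case False
      then have "j \<notin> keys m" "j \<notin> keys m'" using m m' by auto
      then show ?thesis by (simp add: in_keys_iff)
    qed
  qed
  ultimately show ?thesis by (rule finite_imageD)
qed

text \<open>Multiples of \<open>X - z\<close> have codimension one, and \<open>\<eta>\<close>, not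
  vanishing at \<open>z\<close>, supplies the missing direction.\<close>

lemma functional_vanishes:
  fixes q :: "'k::field poly \<Rightarrow> 'k"
  assumes q: "lin q" and \<eta>: "\<eta> \<in> pl (Suc s)" "poly \<eta> z \<noteq> 0" "q \<eta> = 0" and "s \<le> k"
    and ker: "\<And>w. w \<in> pl k \<Longrightarrow> q ([:- z, 1:] * w) = 0" and w: "w \<in> pl (Suc k)"
  shows "q w = 0"
proof -
  have "w \<in> pl (1 + k)" using w by (simp add: One_nat_def)
  then obtain c \<rho> where c: "c \<in> pl 1" and \<rho>: "\<rho> \<in> pl k" and eq: "w = \<eta> * c + [:- z, 1:] ^ 1 * \<rho>"
    using division_at_point_bounded[OF \<eta>(2,1) _ \<open>s \<le> k\<close>] by blast
  obtain x where "c = [:x:]"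
    using c by (auto simp: pl_iff_degree elim: degree_eq_zeroE intro: that[of 0])
  then have "\<eta> * c = smult x \<eta>"
    by (simp add: mult_pCons_right)
  then show ?thesis
    using ker[OF \<rho>] \<eta>(3) by (simp add: eq lin_add[OF q] lin_smult[OF q])
qed

section \<open>Failure of maximal rank and Gorenstein duality\<close>

context perazzo_setup
begin

lemma zero_annih: "0 \<in> annW i"
  by (auto simp: annih_def lin_zero[OF lin_phi])

lemma lin_phiW: "\<beta> \<in> phi ` {..n} \<Longrightarrow> lin \<beta>"
  using lin_phi by auto

text \<open>A vanishing annihilator in degree \<open>d - i\<close> says that the functionals
  \<open>phi j (X^a * w)\<close> with \<open>a < i\<close> have no common kernel, so they span the
  dual space. Equivalently, derivatives of order \<open>i - 1\<close> of the \<open>p j\<close> span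
  all binary forms of degree \<open>d - i\<close>.\<close>

lemma phi_represents:
  assumes ann: "annW (d - i) \<subseteq> {0}" and "i \<le> d" and v: "lin v"
  shows "\<exists>t. (\<forall>j\<le>n. t j \<in> pl i) \<and> (\<forall>w\<in>pl (Suc (d - i)). v w = (\<Sum>j\<le>n. phi j (t j * w)))"
proof -
  let ?x = "\<lambda>(j, a) w. phi j (monom 1 a * w)"
  have "\<exists>c. \<forall>w\<in>pl (Suc (d - i)). v w = (\<Sum>ja\<in>{..n} \<times> {..<i}. c ja * ?x ja w)"
  proof (rule functional_in_span[where scale = smult])
    show "u - smult c w \<in> pl (Suc (d - i))" if "u \<in> pl (Suc (d - i))" "w \<in> pl (Suc (d - i))" for u w :: "'k poly" and c
      using that by (intro pl_diff pl_smult)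
    show "?x ja (u - smult c w) = ?x ja u - c * ?x ja w" for ja u w c
      by (cases ja) (simp add: right_diff_distrib lin_diff[OF lin_phi] lin_smult[OF lin_phi])
    show "v (u - smult c w) = v u - c * v w" for u w c
      by (simp add: lin_diff[OF v] lin_smult[OF v])
    show "v w = 0" if w: "w \<in> pl (Suc (d - i))" and x: "\<And>ja. ja \<in> {..n} \<times> {..<i} \<Longrightarrow> ?x ja w = 0" for w
    proof -
      have "phi j (w * w') = 0" if "j \<le> n" "w' \<in> pl i" for j w'
        using poly_mult_as_sum_pl[OF lin_phi[of j] that(2), of w] x[of "(j, _)"] that(1)
        by (simp add: mult.commute)
      then have "w \<in> annW (d - i)"
        using w \<open>i \<le> d\<close> by (auto simp: annih_def)
      then have "w = 0" using ann by auto
      then show ?thesis by (simp add: lin_zero[OF v])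
    qed
  qed simp
  then obtain c where c: "\<And>w. w \<in> pl (Suc (d - i)) \<Longrightarrow> v w = (\<Sum>ja\<in>{..n} \<times> {..<i}. c ja * ?x ja w)"
    by blast
  define t where "t j = (\<Sum>a<i. monom (c (j, a)) a)" for j
  have t: "t j \<in> pl i" for j
    unfolding t_def by (intro pl_sum pl_monom) auto
  have "v w = (\<Sum>j\<le>n. phi j (t j * w))" if "w \<in> pl (Suc (d - i))" for w
  proof -
    have "coeff (t j) a = c (j, a)" if "a < i" for j a
      using that by (simp add: t_def coeff_sum)
    then have "phi j (t j * w) = (\<Sum>a<i. c (j, a) * phi j (monom 1 a * w))" for j
      by (simp add: poly_mult_as_sum_pl[OF lin_phi t])
    then show ?thesis
      using c[OF that] by (simp add: sum.cartesian_product split_def)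
  qed
  with t show ?thesis by blast
qed

lemma mult_linear_forms:
  fixes l \<theta> :: "'k mpoly"
  assumes "l \<in> Rdeg n 1" "\<theta> \<in> Rdeg n i"
  shows "l * \<theta> \<in> Rdeg n (Suc i)"
  using forms_mult[OF assms] by (simp add: One_nat_def)

text \<open>For every linear form, the condition in degree \<open>d - i\<close> breaks injectivity
  and the one in degree \<open>i + 1\<close> breaks surjectivity.\<close>

lemma no_WLP:
  assumes i: "i < d" "annW (Suc i) \<subseteq> {0}" "annW (d - i) \<subseteq> {0}"
  shows "\<not> has_WLP n f"
proof
  assume "has_WLP n f"
  then obtain l where l: "l \<in> Rdeg n 1" and *: "mult_injective n f l i \<or> mult_surjective n f l i"
    unfolding has_WLP_def by blast
  have l2: "ev n l \<in> pl 2"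
    using ev_pl[OF l] by (simp add: numeral_2_eq_2 One_nat_def)
  from * show False
  proof
    assume inj: "mult_injective n f l i"
    obtain v w where v: "lin v" "\<And>t. t \<in> pl (d - i) \<Longrightarrow> v (ev n l * t) = 0"
      and w: "w \<in> pl (Suc (d - i))" "v w \<noteq> 0"
      using functional_killing_multiples[OF l2, of "d - i"] by blast
    obtain t where t: "\<And>j. j \<le> n \<Longrightarrow> t j \<in> pl i"
      and vt: "\<And>w. w \<in> pl (Suc (d - i)) \<Longrightarrow> v w = (\<Sum>j\<le>n. phi j (t j * w))"
      using phi_represents[OF i(3) _ v(1)] i(1) by auto
    \<comment> \<open>This operator is linear in the \<open>y_j\<close> and sends \<open>f\<close>
      to the binary form given by \<open>v\<close>, which the \<open>U, V\<close>-part of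
      \<open>l\<close> kills.\<close>
    obtain \<theta> where \<theta>: "\<theta> \<in> Rdeg n i" "ev n \<theta> = 0" "\<And>j. j \<le> n \<Longrightarrow> evy n j \<theta> = t j"
      using ev_lift[of 0 i n t] t by auto
    have "killed (Suc i) 0 (\<lambda>j. evy n j (l * \<theta>))"
      unfolding killed_def
    proof
      fix u :: "'k poly" assume "u \<in> pl (Suc (d - Suc i))"
      then have u: "u \<in> pl (d - i)" using i(1) by (simp add: Suc_diff_Suc)
      have "(\<Sum>j\<le>n. phi j (evy n j (l * \<theta>) * u)) = (\<Sum>j\<le>n. phi j (t j * (ev n l * u)))"
        using \<theta> by (intro sum.cong refl) (simp add: evy_mult mult_ac)
      also have "\<dots> = v (ev n l * u)"
        using l2 u by (intro vt[symmetric] pl_mult) auto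
      also have "\<dots> = 0" by (rule v(2)[OF u])
      finally show "gam (0 * u) + (\<Sum>j\<le>n. phi j (evy n j (l * \<theta>) * u)) = 0"
        by (simp add: lin_zero[OF lin_gam])
    qed
    then have "act (l * \<theta>) f = 0"
      using act_f_eq_0_iff[OF mult_linear_forms[OF l \<theta>(1)]] i(1) \<theta>(2) zero_annih by (simp add: ev_mult)
    then have "act \<theta> f = 0"
      using inj \<theta>(1) by (auto simp: mult_injective_def)
    then have "killed i 0 (\<lambda>j. evy n j \<theta>)"
      using act_f_eq_0_iff[OF \<theta>(1)] i(1) \<theta>(2) by simp
    then have "(\<Sum>j\<le>n. phi j (evy n j \<theta> * w)) = 0"
      using w(1) by (simp add: killed_def lin_zero[OF lin_gam])
    also have "(\<Sum>j\<le>n. phi j (evy n j \<theta> * w)) = v w"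
      using \<theta>(3) vt[OF w(1)] by simp
    finally show False using w(2) by simp
  next
    assume surj: "mult_surjective n f l i"
    obtain v w where "lin v" and v: "\<And>t. t \<in> pl (Suc i) \<Longrightarrow> v (ev n l * t) = 0"
      and w: "w \<in> pl (Suc (Suc i))" "v w \<noteq> 0"
      using functional_killing_multiples[OF l2, of "Suc i"] by blast
    obtain \<psi> where \<psi>: "\<psi> \<in> Rdeg n (Suc i)" "ev n \<psi> = w"
      using ev_lift[OF w(1), of n "\<lambda>_. 0"] by auto
    obtain \<theta> where \<theta>: "\<theta> \<in> Rdeg n i" "act (\<psi> - l * \<theta>) f = 0"
      using surj \<psi>(1) by (auto simp: mult_surjective_def One_nat_def)
    have "\<psi> - l * \<theta> \<in> Rdeg n (Suc i)"
      by (intro forms_diff \<psi>(1) mult_linear_forms[OF l \<theta>(1)])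
    then have "ev n (\<psi> - l * \<theta>) \<in> annW (Suc i)"
      using act_f_eq_0_iff[of "\<psi> - l * \<theta>" "Suc i"] \<theta>(2) i(1) by simp
    then have "w = ev n l * ev n \<theta>"
      using i(2) \<psi>(2) by (auto simp: ev_diff ev_mult)
    then show False
      using v[OF ev_pl[OF \<theta>(1)]] w(2) by simp
  qed
qed

text \<open>If \<open>l * w\<close> pairs to zero with degree \<open>i\<close>, then
  \<open>w\<close> kills \<open>f\<close> by injectivity, hence pairs to zero with
  \<open>\<psi>\<close>. So pairing with \<open>\<psi>\<close> is a combination of pairings with
  \<open>l\<close> times monomials, whose coefficients assemble \<open>\<theta>\<close>.\<close>

lemma surjective_of_injective:
  assumes l: "l \<in> Rdeg n 1" and "i < d" and inj: "mult_injective n f l (d - Suc i)"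
  shows "mult_surjective n f l i"
  unfolding mult_surjective_def
proof
  fix \<psi> :: "'k mpoly" assume "\<psi> \<in> Rdeg n (i + 1)"
  then have \<psi>: "\<psi> \<in> Rdeg n (Suc i)" by (simp add: One_nat_def)
  let ?A = "{m. keys m \<subseteq> {..n+2} \<and> tdeg m = i}"
  let ?W = "Rdeg n (d - Suc i) :: 'k mpoly set"
  have "\<exists>c. \<forall>w\<in>?W. pairing (dpc f) (\<psi> * w) = (\<Sum>m\<in>?A. c m * pairing (dpc f) (l * w * single m 1))"
  proof (rule functional_in_span[where scale = "\<lambda>c w. cst c * w"])
    show "finite ?A" by (rule finite_monomials)
    show "u - cst c * w \<in> ?W" if "u \<in> ?W" "w \<in> ?W" for u w c
      using that by (intro forms_diff forms_scale)
    have *: "pairing (dpc f) (P * (u - cst c * w) * Q) = pairing (dpc f) (P * u * Q) - c * pairing (dpc f) (P * w * Q)" for P Q u w c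
    proof -
      have "P * (u - cst c * w) * Q = P * u * Q - cst c * (P * w * Q)"
        by (simp add: algebra_simps)
      then show ?thesis by (simp add: pairing_diff pairing_scale)
    qed
    show "pairing (dpc f) (l * (u - cst c * w) * single m 1)
      = pairing (dpc f) (l * u * single m 1) - c * pairing (dpc f) (l * w * single m 1)" for m u w c
      by (rule *)
    show "pairing (dpc f) (\<psi> * (u - cst c * w)) = pairing (dpc f) (\<psi> * u) - c * pairing (dpc f) (\<psi> * w)" for u w c
      using *[of \<psi> u c w 1] by simp
    show "pairing (dpc f) (\<psi> * w) = 0"
      if w: "w \<in> ?W" and x: "\<And>m. m \<in> ?A \<Longrightarrow> pairing (dpc f) (l * w * single m 1) = 0" for w
    proof -
      have lw: "l * w \<in> Rdeg n (d - i)"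
        using mult_linear_forms[OF l w] \<open>i < d\<close> by (simp add: Suc_diff_Suc)
      have "pairing (dpc f) (l * w * Q) = 0" if "Q \<in> Rdeg n i" for Q
        using x formsD[OF that] by (subst pairing_mult_expand) (auto intro!: sum.neutral simp: in_keys_iff)
      then have "act (l * w) f = 0"
        using act_eq_0_iff_forms[OF f_forms lw] \<open>i < d\<close> by simp
      then have "act w f = 0"
        using inj w by (auto simp: mult_injective_def)
      then show ?thesis
        by (simp add: act_eq_0_iff mult.commute)
    qed
  qed
  then obtain c where c: "\<And>w. w \<in> ?W \<Longrightarrow>
      pairing (dpc f) (\<psi> * w) = (\<Sum>m\<in>?A. c m * pairing (dpc f) (l * w * single m 1))"
    by blast
  define \<theta> where "\<theta> = (\<Sum>m\<in>?A. single m (c m))"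
  have \<theta>: "\<theta> \<in> Rdeg n i"
    unfolding \<theta>_def by (intro forms_sum forms_single) auto
  have "pairing (dpc f) ((\<psi> - l * \<theta>) * w) = 0" if "w \<in> ?W" for w
  proof -
    have "(\<psi> - l * \<theta>) * w = \<psi> * w - (\<Sum>m\<in>?A. cst (c m) * (l * w * single m 1))"
      unfolding \<theta>_def by (subst cst_single_1) (simp add: algebra_simps sum_distrib_left sum_distrib_right)
    then show ?thesis
      using c[OF that] by (simp add: pairing_diff pairing_sum pairing_scale)
  qed
  moreover have "\<psi> - l * \<theta> \<in> Rdeg n (Suc i)"
    by (intro forms_diff \<psi> mult_linear_forms[OF l \<theta>])
  ultimately have "act (\<psi> - l * \<theta>) f = 0"
    using act_eq_0_iff_forms[OF f_forms, of "\<psi> - l * \<theta>" "Suc i"] \<open>i < d\<close> by simp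
  with \<theta> show "\<exists>\<theta>\<in>Rdeg n i. act (\<psi> - l * \<theta>) f = 0" by blast
qed

lemma surjective_above:
  assumes "d \<le> i"
  shows "mult_surjective n f l i"
  unfolding mult_surjective_def
proof
  fix \<psi> :: "'k mpoly" assume "\<psi> \<in> Rdeg n (i + 1)"
  then have "act \<psi> f = 0"
    using assms by (intro act_eq_0_of_degree[OF f_forms]) auto
  then show "\<exists>\<theta>\<in>Rdeg n i. act (\<psi> - l * \<theta>) f = 0"
    by (intro bexI[of _ 0]) (auto simp: forms_zero)
qed

end

text \<open>Here \<open>s\<close> is the initial degree of the annihilator of the \<open>p\<^sub>j\<close>, and \<open>e\<close> that of the annihilator
  of the binary form obtained by applying \<open>\<eta>\<^sup>2\<close> to \<open>g\<close>.\<close>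

locale perazzo_point = perazzo_setup n d p g
  for n d :: nat and p :: "nat \<Rightarrow> 'k::field_char_0 mpoly" and g :: "'k mpoly" +
  fixes s e :: nat and \<eta> \<kappa> :: "'k poly" and z :: 'k and l :: "'k mpoly"
  assumes \<eta>: "\<eta> \<in> annW s" "poly \<eta> z \<noteq> 0"
    and min: "\<And>k. k < s \<Longrightarrow> annW k \<subseteq> {0}"
    and \<kappa>: "\<kappa> \<in> annih {\<lambda>w. gam (\<eta> * \<eta> * w)} (Suc d - 2 * s) e" "poly \<kappa> z \<noteq> 0"
    and min': "\<And>k. k < e \<Longrightarrow> annih {\<lambda>w. gam (\<eta> * \<eta> * w)} (Suc d - 2 * s) k \<subseteq> {0}"
    and l: "l \<in> Rdeg n 1" "ev n l = [:- z, 1:]" "\<And>j. j \<le> n \<Longrightarrow> evy n j l = 0"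
begin

text \<open>The hypothesis on \<open>l * \<theta>\<close> gives the \<open>killed\<close> condition
  for \<open>\<theta>\<close> on multiples of \<open>X - z\<close>. It remains to test on
  \<open>\<eta>\<close>, where the \<open>phi j\<close> terms vanish and only
  \<open>gam (t0 * \<eta>)\<close> is left.\<close>

lemma injectiveI:
  assumes "i < d" "s \<le> d - i"
    and *: "\<And>t0 t. t0 \<in> pl (Suc i) \<Longrightarrow> (\<And>j. j \<le> n \<Longrightarrow> t j \<in> pl i) \<Longrightarrow> [:- z, 1:] * t0 \<in> annW (Suc i) \<Longrightarrow>
      killed (Suc i) ([:- z, 1:] * t0) (\<lambda>j. [:- z, 1:] * t j) \<Longrightarrow> t0 \<in> annW i \<and> gam (t0 * \<eta>) = 0"
  shows "mult_injective n f l i"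
  unfolding mult_injective_def
proof (intro ballI impI)
  fix \<theta> assume \<theta>: "\<theta> \<in> Rdeg n i" and act: "act (l * \<theta>) f = 0"
  let ?u = "ev n \<theta>" and ?t = "\<lambda>j. evy n j \<theta>"
  have t: "?u \<in> pl (Suc i)" "\<And>j. j \<le> n \<Longrightarrow> ?t j \<in> pl i"
    using ev_pl[OF \<theta>] evy_pl[OF \<theta>] by auto
  have A: "[:- z, 1:] * ?u \<in> annW (Suc i)" and "killed (Suc i) ([:- z, 1:] * ?u) (\<lambda>j. evy n j (l * \<theta>))"
    using act act_f_eq_0_iff[OF mult_linear_forms[OF l(1) \<theta>]] \<open>i < d\<close> l by (auto simp: ev_mult)
  then have K: "killed (Suc i) ([:- z, 1:] * ?u) (\<lambda>j. [:- z, 1:] * ?t j)"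
    using l by (auto simp: killed_def evy_mult)
  define q where "q w = gam (?u * w) + (\<Sum>j\<le>n. phi j (?t j * w))" for w
  have q: "lin q"
    by (simp add: lin_def q_def distrib_left lin_add[OF lin_gam] lin_add[OF lin_phi] lin_smult[OF lin_gam]
        lin_smult[OF lin_phi] sum.distrib sum_distrib_left)
  have "phi j (?t j * \<eta>) = 0" if "j \<le> n" for j
    using annihD[OF \<eta>(1), of "phi j" "?t j"] that pl_mono[OF t(2)[OF that], of "d - s"] \<open>s \<le> d - i\<close> \<open>i < d\<close>
    by (auto simp: mult.commute)
  then have "q \<eta> = 0"
    using *[OF t A K] by (simp add: q_def)
  moreover have "q ([:- z, 1:] * w) = 0" if "w \<in> pl (d - i)" for w
    using K that \<open>i < d\<close> by (simp add: killed_def q_def Suc_diff_Suc mult_ac)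
  ultimately have "q w = 0" if "w \<in> pl (Suc (d - i))" for w
    using functional_vanishes[OF q annih_pl[OF \<eta>(1)] \<eta>(2) _ \<open>s \<le> d - i\<close>] that by blast
  then have "killed i ?u ?t"
    by (simp add: killed_def q_def)
  then show "act \<theta> f = 0"
    using *[OF t A K] act_f_eq_0_iff[OF \<theta>] \<open>i < d\<close> by simp
qed

lemma injective_low:
  assumes "Suc i < s" "i < d" "s \<le> d - i"
  shows "mult_injective n f l i"
proof (rule injectiveI[OF assms(2,3)])
  fix t0 assume "[:- z, 1:] * t0 \<in> annW (Suc i)"
  then have "[:- z, 1:] * t0 = 0" using min[OF assms(1)] by blast
  then have "t0 = 0" by simp
  then show "t0 \<in> annW i \<and> gam (t0 * \<eta>) = 0"
    by (simp add: zero_annih lin_zero[OF lin_gam])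
qed

text \<open>Either \<open>annih_cancel_linear\<close> has enough room, or
  \<open>d + 1 = 2 * s\<close>, the boundary case settled by \<open>annih_critical\<close>.\<close>

lemma injective_critical:
  assumes s: "Suc i = s" and "i < d" "s \<le> d - i"
  shows "mult_injective n f l i"
proof (rule injectiveI[OF assms(2,3)])
  fix t0 assume t0: "t0 \<in> pl (Suc i)" and A: "[:- z, 1:] * t0 \<in> annW (Suc i)"
  have "t0 = 0"
  proof (cases "i + s < d")
    case True
    then have "t0 \<in> annW i"
      using annih_cancel_linear[OF lin_phiW \<eta> t0 A] by simp
    then show ?thesis using min[of i] s by auto
  next
    case False
    then have "Suc d = 2 * s" using assms by simp
    moreover have "annW (s - 1) \<subseteq> {0}" using min s by auto
    ultimately show ?thesis
      using annih_critical[OF lin_phi phi_independent n_pos \<eta>, of t0] t0 A s by auto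
  qed
  then show "t0 \<in> annW i \<and> gam (t0 * \<eta>) = 0"
    by (simp add: zero_annih lin_zero[OF lin_gam])
qed

text \<open>Here \<open>t0 = \<eta> * \<alpha>\<close>. Testing on multiples of
  \<open>\<eta>\<close> removes the \<open>phi j\<close> terms, so \<open>(X - z) * \<alpha>\<close>
  annihilates the form of degree \<open>d - 2 * s\<close> obtained by applying
  \<open>\<eta>^2\<close> to \<open>g\<close>. The alternatives in \<open>e\<close> allow cancelling
  \<open>X - z\<close>, or force \<open>\<alpha> = 0\<close>.\<close>

lemma injective_middle:
  assumes "s \<le> i" "i + s < d" and e: "i + e \<le> d - s \<or> Suc i < s + e"
  shows "mult_injective n f l i"
proof (rule injectiveI)
  show "i < d" "s \<le> d - i" using assms by auto
  fix t0 t
  assume t0: "t0 \<in> pl (Suc i)" and t: "\<And>j. j \<le> n \<Longrightarrow> t j \<in> pl i" and A: "[:- z, 1:] * t0 \<in> annW (Suc i)"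
    and K: "killed (Suc i) ([:- z, 1:] * t0) (\<lambda>j. [:- z, 1:] * t j)"
  have t0A: "t0 \<in> annW i"
    using annih_cancel_linear[OF lin_phiW \<eta> t0 A] assms by simp
  obtain \<alpha> where \<alpha>: "\<alpha> \<in> pl (Suc i - s)" "t0 = \<eta> * \<alpha>"
    using annih_principal[OF lin_phiW \<eta> min t0A] assms by auto
  define a where "a = i - s"
  have a: "Suc i - s = Suc a" "i = a + s" using assms by (auto simp: a_def)
  define G where "G w = gam (\<eta> * \<eta> * w)" for w
  have G: "lin G" unfolding G_def[abs_def] by (rule lin_mult[OF lin_gam])
  have "G ([:- z, 1:] * \<alpha> * w) = 0" if w: "w \<in> pl (Suc d - 2 * s - Suc a)" for w
  proof -
    have \<eta>w: "\<eta> * w \<in> pl (Suc (d - Suc i))"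
      using annih_pl[OF \<eta>(1)] w a assms by (intro pl_mult) auto
    have "phi j ([:- z, 1:] * t j * (\<eta> * w)) = 0" if j: "j \<le> n" for j
    proof -
      have "[:- z, 1:] * t j \<in> pl (Suc i)"
        using t[OF j] by (intro pl_mult[of _ 2 _ i]) (auto simp: pl_iff_degree)
      then have "[:- z, 1:] * t j * w \<in> pl (d - s)"
        using pl_mult[OF _ w, of "[:- z, 1:] * t j" "Suc i" "d - s"] a assms by simp
      then have "phi j (\<eta> * ([:- z, 1:] * t j * w)) = 0"
        using annihD[OF \<eta>(1)] j by auto
      then show ?thesis by (simp add: mult_ac)
    qed
    then have "(\<Sum>j\<le>n. phi j ([:- z, 1:] * t j * (\<eta> * w))) = 0"
      by (intro sum.neutral) auto
    then have "gam ([:- z, 1:] * t0 * (\<eta> * w)) = 0"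
      using bspec[OF K[unfolded killed_def] \<eta>w] by simp
    then show ?thesis by (simp add: G_def \<alpha>(2) mult_ac)
  qed
  moreover have L\<alpha>: "[:- z, 1:] * \<alpha> \<in> pl (Suc (Suc a))"
    using \<alpha>(1) a by (intro pl_mult[of _ 2 _ "Suc a"]) (auto simp: pl_iff_degree)
  ultimately have L: "[:- z, 1:] * \<alpha> \<in> annih {G} (Suc d - 2 * s) (Suc a)"
    by (simp add: annih_def)
  have "\<alpha> \<in> annih {G} (Suc d - 2 * s) a"
  proof (cases "Suc a < e")
    case True
    then have "[:- z, 1:] * \<alpha> = 0"
      using L min'[OF True] unfolding G_def[abs_def] by blast
    then have "\<alpha> = 0" by simp
    then show ?thesis by (simp add: annih_def lin_zero[OF G])
  next
    case False
    then have "a + e < Suc d - 2 * s" using e a assms by auto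
    then show ?thesis
      using annih_cancel_linear[of "{G}" \<kappa> "Suc d - 2 * s" e z \<alpha> a] G \<kappa> \<alpha>(1) L a
      by (simp add: G_def[abs_def])
  qed
  \<comment> \<open>This value is \<open>gam (t0 * \<eta>)\<close>, as required by
    \<open>injectiveI\<close>.\<close>
  then have "G (\<alpha> * 1) = 0"
    using a assms by (intro annihD[of \<alpha> "{G}" "Suc d - 2 * s" a G 1]) (auto simp: pl_iff_degree)
  then show "t0 \<in> annW i \<and> gam (t0 * \<eta>) = 0"
    using t0A by (simp add: G_def \<alpha>(2) mult_ac)
qed

lemma WLP:
  assumes "2 * s \<le> d + 2"
  shows "has_WLP n f"
  unfolding has_WLP_def
proof (intro bexI[OF _ l(1)] allI)
  fix i
  have inj: "mult_injective n f l k" if "k < d" "k < s" "s \<le> d - k" for k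
    using that injective_low[of k] injective_critical[of k] by (cases "Suc k < s") auto
  \<comment> \<open>The bound on \<open>s\<close> makes the cases exhaustive: \<open>i < s\<close>
    and \<open>d - i < s\<close> force \<open>i = s - 1\<close>, which falls under the third
    case.\<close>
  consider "d \<le> i" | "i < d" "i < s" "s \<le> d - i" | "i < d" "d - Suc i < s" "s \<le> Suc i"
    | "s \<le> i" "i + s < d"
    using assms by linarith
  then show "mult_injective n f l i \<or> mult_surjective n f l i"
  proof cases
    case 1
    then show ?thesis using surjective_above by blast
  next
    case 2
    then show ?thesis using inj by blast
  next
    case 3
    then have "mult_injective n f l (d - Suc i)" by (intro inj) auto
    then show ?thesis using surjective_of_injective[OF l(1) \<open>i < d\<close>] by blast
  next
    case 4
    show ?thesis
    proof (cases "i + e \<le> d - s")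
      case True
      then show ?thesis using injective_middle[OF 4] by blast
    next
      case False
      \<comment> \<open>Now \<open>d - i < s + e\<close>, which is the second alternative of
        \<open>injective_middle\<close> in the dual degree.\<close>
      then have "mult_injective n f l (d - Suc i)"
        using 4 by (intro injective_middle) auto
      then show ?thesis using surjective_of_injective[OF l(1)] 4 by auto
    qed
  qed
qed

end

section \<open>The criterion in terms of the initial degree\<close>

context perazzo_setup
begin

definition init_deg :: nat where
  "init_deg = (LEAST k. \<not> annW k \<subseteq> {0})"

lemma init_deg_le: "init_deg \<le> d"
  and init_deg_nonzero: "\<not> annW init_deg \<subseteq> {0}"
proof -
  have "1 \<in> annW d"
    by (auto simp: annih_def pl_iff_degree lin_zero[OF lin_phi])
  then have "\<not> annW d \<subseteq> {0}" by auto
  then show "init_deg \<le> d" "\<not> annW init_deg \<subseteq> {0}"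
    unfolding init_deg_def by (rule Least_le, rule LeastI)
qed

lemma annW_eq_0_iff: "annW k \<subseteq> {0} \<longleftrightarrow> k < init_deg"
proof
  assume k: "annW k \<subseteq> {0}"
  show "k < init_deg"
  proof (rule ccontr)
    assume "\<not> k < init_deg"
    then have "annW init_deg \<subseteq> annW k" using annih_mono[of _ "phi ` {..n}" d init_deg k] by auto
    with k init_deg_nonzero show False by auto
  qed
next
  assume "k < init_deg"
  then show "annW k \<subseteq> {0}" unfolding init_deg_def using not_less_Least by blast
qed

lemma WLP_iff_init_deg: "has_WLP n f \<longleftrightarrow> 2 * init_deg \<le> d + 2"
proof
  assume "2 * init_deg \<le> d + 2"
  obtain \<eta> where \<eta>: "\<eta> \<in> annW init_deg" "\<eta> \<noteq> 0"
    using init_deg_nonzero by auto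
  let ?A = "annih {\<lambda>w. gam (\<eta> * \<eta> * w)} (Suc d - 2 * init_deg)"
  define e where "e = (LEAST k. \<not> ?A k \<subseteq> {0})"
  have "1 \<in> ?A (Suc d - 2 * init_deg)"
    by (auto simp: annih_def pl_iff_degree lin_zero[OF lin_gam])
  then have "\<not> ?A (Suc d - 2 * init_deg) \<subseteq> {0}" by auto
  then have "\<not> ?A e \<subseteq> {0}" unfolding e_def by (rule LeastI)
  then obtain \<kappa> where \<kappa>: "\<kappa> \<in> ?A e" "\<kappa> \<noteq> 0" by auto
  have min': "?A k \<subseteq> {0}" if "k < e" for k
    using not_less_Least[OF that[unfolded e_def]] by blast
  have "finite {z. poly (\<eta> * \<kappa>) z = 0}"
    using \<eta> \<kappa> by (intro poly_roots_finite) auto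
  \<comment> \<open>A general point: it avoids the finitely many roots of both \<open>\<eta>\<close>
    and \<open>\<kappa>\<close>.\<close>
  then obtain z where z: "poly (\<eta> * \<kappa>) z \<noteq> 0"
    using ex_new_if_finite[OF infinite_UNIV_char_0] by blast
  obtain l where l: "l \<in> Rdeg n 1" "ev n l = [:- z, 1:]" "\<forall>j\<le>n. evy n j l = 0"
    using ev_lift[of "[:- z, 1:]" 1 n "\<lambda>_. 0"] by (auto simp: pl_iff_degree)
  interpret perazzo_point n d p g init_deg e \<eta> \<kappa> z l
    by unfold_locales (use \<eta> \<kappa> z l min' annW_eq_0_iff in auto)
  show "has_WLP n f" by (rule WLP) fact
next
  assume "has_WLP n f"
  show "2 * init_deg \<le> d + 2"
  proof (rule ccontr)
    assume "\<not> 2 * init_deg \<le> d + 2"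
    \<comment> \<open>With this choice \<open>d - i\<close> is \<open>init_deg - 1\<close>, and the
      negated bound says precisely that \<open>i + 1 < init_deg\<close>.\<close>
    moreover define i where "i = Suc d - init_deg"
    ultimately have "i < d" "Suc i < init_deg" "d - i < init_deg"
      using init_deg_le by auto
    then show False
      using no_WLP[of i] \<open>has_WLP n f\<close> annW_eq_0_iff by blast
  qed
qed

end

section \<open>The h-vector\<close>

interpretation mpoly: vector_space "mscale :: 'k::field \<Rightarrow> 'k mpoly \<Rightarrow> 'k mpoly"
proof
  fix a b :: 'k and P Q :: "'k mpoly"
  show "mscale a (P + Q) = mscale a P + mscale a Q"
    by (simp add: mscale_def distrib_left)
  show "mscale (a + b) P = mscale a P + mscale b P"
    by (simp add: mscale_def cst_def single_add distrib_right)
  show "mscale a (mscale b P) = mscale (a * b) P"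
    by (simp add: mscale_def cst_def mult_single flip: mult.assoc)
  show "mscale 1 P = P"
    by (simp add: mscale_def cst_def)
qed

text \<open>Independence is stated for an indexed family, so that injectivity need not be shown
  beforehand: equal members give a relation with coefficients \<open>1\<close> and
  \<open>-1\<close>.\<close>

lemma (in vector_space) dim_span_family:
  assumes "finite I" and ind: "\<And>c. (\<Sum>x\<in>I. scale (c x) (B x)) = 0 \<Longrightarrow> \<forall>x\<in>I. c x = 0"
  shows "dim (span (B ` I)) = card I"
proof -
  have inj: "inj_on B I"
  proof (rule inj_onI, rule ccontr)
    fix x y assume xy: "x \<in> I" "y \<in> I" "B x = B y" "x \<noteq> y"
    define c where "c u = (if u = x then 1 else if u = y then - 1 else 0 :: 'a)" for u
    have "(\<Sum>u\<in>I. scale (c u) (B u)) = (\<Sum>u\<in>{x, y}. scale (c u) (B u))"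
      using xy assms(1) by (intro sum.mono_neutral_right) (auto simp: c_def)
    also have "\<dots> = 0"
      using xy by (simp add: c_def)
    finally show False
      using ind[of c] xy by (auto simp: c_def)
  qed
  have "independent (B ` I)"
    unfolding dependent_finite[OF finite_imageI[OF assms(1)]]
  proof (rule notI, elim exE conjE)
    fix u assume ex: "\<exists>v\<in>B ` I. u v \<noteq> 0" and 0: "(\<Sum>v\<in>B ` I. scale (u v) v) = 0"
    have "(\<Sum>x\<in>I. scale (u (B x)) (B x)) = 0"
      using 0 by (simp add: sum.reindex[OF inj])
    with ind[of "\<lambda>x. u (B x)"] ex show False by auto
  qed
  then show ?thesis
    using card_image[OF inj] by (simp add: dim_eq_card_independent)
qed

lemma dpc_mscale: "dpc (mscale c P) k = c * dpc P k"
  by (simp add: mscale_def dpc_cst_mult)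

lemma pdiffs_eq_act: "pdiffs m f = act (single m 1) f"
  for f :: "'k::field_char_0 mpoly"
  by (simp add: dpc_eq_iff dpc_pdiffs dpc_act pairing_mult_single add.commute)

lemma act_add: "act (\<theta> + \<theta>') f = act \<theta> f + act \<theta>' f"
  and act_zero: "act 0 f = 0"
  and act_single: "act (single m c) f = mscale c (pdiffs m f)"
  for f \<theta> \<theta>' :: "'k::field_char_0 mpoly"
proof -
  show "act (\<theta> + \<theta>') f = act \<theta> f + act \<theta>' f"
    by (simp add: dpc_eq_iff dpc_act dpc_add distrib_right pairing_add)
  show "act 0 f = 0"
    by (simp add: act_def)
  have "pairing (dpc f) (single m c * single k 1) = c * pairing (dpc f) (single m 1 * single k 1)" for k
    by (subst cst_single_1) (simp only: mult.assoc pairing_scale)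
  then show "act (single m c) f = mscale c (pdiffs m f)"
    by (simp add: dpc_eq_iff pdiffs_eq_act dpc_act dpc_mscale)
qed

lemma act_sum: "act (\<Sum>a\<in>A. F a) f = (\<Sum>a\<in>A. act (F a) f)"
  for f :: "'k::field_char_0 mpoly"
  by (induction A rule: infinite_finite_induct) (simp_all add: act_zero act_add)

lemma act_as_sum: "act \<theta> f = (\<Sum>m\<in>keys \<theta>. mscale (lookup \<theta> m) (pdiffs m f))"
  by (simp add: act_def mscale_def)

section \<open>Spanning sets for the derivatives of a given order\<close>

context perazzo_setup
begin

lemma dpc_act_f:
  assumes \<theta>: "\<theta> \<in> Rdeg n i" and "i \<le> d"
  shows "keys k \<subseteq> {..n+2} \<Longrightarrow> tdeg k = d - i \<Longrightarrow> dpc (act \<theta> f) k =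
      gam (ev n \<theta> * hz n k) + (\<Sum>j\<le>n. phi j (evy n j \<theta> * hz n k)) + (\<Sum>j\<le>n. phi j (ev n \<theta> * hy n j k))"
    and "\<not> (keys k \<subseteq> {..n+2} \<and> tdeg k = d - i) \<Longrightarrow> dpc (act \<theta> f) k = 0"
proof -
  assume "keys k \<subseteq> {..n+2}" "tdeg k = d - i"
  then have "single k 1 \<in> Rdeg n (d - i)"
    by (rule forms_single)
  then show "dpc (act \<theta> f) k =
      gam (ev n \<theta> * hz n k) + (\<Sum>j\<le>n. phi j (evy n j \<theta> * hz n k)) + (\<Sum>j\<le>n. phi j (ev n \<theta> * hy n j k))"
    using pairing_mult_eq[OF \<theta>, of "single k 1" "d - i"] \<open>i \<le> d\<close> by (simp add: dpc_act ev_single evy_single)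
next
  assume k: "\<not> (keys k \<subseteq> {..n+2} \<and> tdeg k = d - i)"
  have "dpc f (m + k) = 0" if "m \<in> keys \<theta>" for m
    using formsD[OF f_forms, of "m + k"] formsD[OF \<theta>, of m] that k \<open>i \<le> d\<close>
    by (auto simp: dpc_def tdeg_add in_keys_iff keys_add_nat)
  then show "dpc (act \<theta> f) k = 0" by (simp add: dpc_act pairing_mult_single)
qed

text \<open>The divided power monomial \<open>u^a v^(k-a) / (a! (k-a)!)\<close>.\<close>

definition E :: "nat \<Rightarrow> nat \<Rightarrow> 'k mpoly" where
  "E k a = single (mon n a (k - a)) (inverse (mfact (mon n a (k - a))))"

lemma dpc_E: "dpc (E k a) m = (if m = mon n a (k - a) then 1 else 0)"
  by (auto simp: dpc_def E_def lookup_single mfact_nonzero)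

lemma mon_eq_iff: "mon n a b = mon n a' b' \<longleftrightarrow> a = a' \<and> b = b'"
  by (auto simp: lookup_mon dest: arg_cong[of _ _ "\<lambda>m. (lookup m (n + 1), lookup m (n + 2))"])

lemma dpc_sum_E:
  "dpc (\<Sum>a\<le>k. mscale (x a) (E k a)) m =
    (if \<exists>a\<le>k. m = mon n a (k - a) then x (lookup m (n + 1)) else 0)"
proof (cases "\<exists>a\<le>k. m = mon n a (k - a)")
  case True
  then obtain a where a: "a \<le> k" "m = mon n a (k - a)" by blast
  have "dpc (\<Sum>a\<le>k. mscale (x a) (E k a)) m = (\<Sum>b\<le>k. if b = a then x b else 0)"
    unfolding dpc_sum by (intro sum.cong) (auto simp: dpc_mscale dpc_E mon_eq_iff a)
  also have "\<dots> = x (lookup m (n + 1))"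
    using a by (simp add: lookup_mon)
  finally show ?thesis using True by (simp only: if_True)
qed (auto simp: dpc_sum dpc_mscale dpc_E)

text \<open>The coefficients at monomials containing one \<open>x_j\<close> are tests of
  \<open>ev n \<theta>\<close> in \<open>annW\<close>, so they vanish and a binary form
  remains.\<close>

lemma act_f_expand:
  assumes \<theta>: "\<theta> \<in> Rdeg n i" and "i \<le> d" and ann: "ev n \<theta> \<in> annW i"
  shows "act \<theta> f = (\<Sum>a\<le>d - i. mscale (gam (ev n \<theta> * monom 1 a) + (\<Sum>j\<le>n. phi j (evy n j \<theta> * monom 1 a))) (E (d - i) a))"
  unfolding dpc_eq_iff
proof
  fix k
  let ?x = "\<lambda>a. gam (ev n \<theta> * monom 1 a) + (\<Sum>j\<le>n. phi j (evy n j \<theta> * monom 1 a))"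
  have "dpc (act \<theta> f) k = (if \<exists>a\<le>d - i. k = mon n a (d - i - a) then ?x (lookup k (n + 1)) else 0)"
  proof (cases "keys k \<subseteq> {..n+2} \<and> tdeg k = d - i")
    case True
    then have "single k 1 \<in> Rdeg n (d - i)"
      by (intro forms_single) auto
    then have "hy n j k \<in> pl (d - i)" if "j \<le> n" for j
      using evy_pl[of "single k 1" "{..n+2}" "d - i" j n] that by (simp add: evy_single)
    then have "(\<Sum>j\<le>n. phi j (ev n \<theta> * hy n j k)) = 0"
      using annihD[OF ann] by (intro sum.neutral) auto
    then have *: "dpc (act \<theta> f) k = gam (ev n \<theta> * hz n k) + (\<Sum>j\<le>n. phi j (evy n j \<theta> * hz n k))"
      using dpc_act_f(1)[OF \<theta> \<open>i \<le> d\<close>] True by simp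
    show ?thesis
    proof (cases "\<forall>j\<le>n. lookup k j = 0")
      case z: True
      then have "\<exists>a\<le>d - i. k = mon n a (d - i - a)"
        using tdeg_mon_eq[of k n "d - i"] True by blast
      then show ?thesis using z * by (simp add: hz_def)
    next
      case False
      then have "\<nexists>a. k = mon n a (d - i - a)"
        by (auto simp: lookup_mon)
      moreover have "hz n k = (0 :: 'k poly)"
        unfolding hz_def using False by (rule if_not_P)
      ultimately show ?thesis
        using * by (auto simp: lin_zero[OF lin_gam] lin_zero[OF lin_phi])
    qed
  next
    case False
    have "\<not> (\<exists>a\<le>d - i. k = mon n a (d - i - a))"
    proof
      assume "\<exists>a\<le>d - i. k = mon n a (d - i - a)"
      then obtain a where "a \<le> d - i" "k = mon n a (d - i - a)" by blast
      then have "keys k \<subseteq> {..n+2} \<and> tdeg k = d - i"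
        using keys_mon[of n a "d - i - a"] by (auto simp: tdeg_mon)
      with False show False by blast
    qed
    then show ?thesis
      using dpc_act_f(2)[OF \<theta> \<open>i \<le> d\<close> False] by (simp only: if_False)
  qed
  then show "dpc (act \<theta> f) k = dpc (\<Sum>a\<le>d - i. mscale (?x a) (E (d - i) a)) k"
    by (simp only: dpc_sum_E)
qed

definition derivs :: "nat \<Rightarrow> 'k mpoly set" where
  "derivs i = {pdiffs m f | m. keys m \<subseteq> {..n+2} \<and> tdeg m = i}"

lemma hvec_eq: "hvec n f i = mpoly.dim (derivs i)"
  by (simp add: hvec_def derivs_def)

lemma act_in_span: "\<theta> \<in> Rdeg n i \<Longrightarrow> act \<theta> f \<in> mpoly.span (derivs i)"
  unfolding act_as_sum using formsD[of \<theta> "{..n+2}" i]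
  by (intro mpoly.span_sum mpoly.span_scale mpoly.span_base) (auto simp: derivs_def in_keys_iff)

definition D :: "nat \<Rightarrow> nat \<Rightarrow> 'k mpoly" where
  "D i a = pdiffs (mon n a (i - a)) f"

text \<open>A derivative involving some \<open>y_j\<close> has no \<open>y\<close>-free component,
  so \<open>act_f_expand\<close> applies to it.\<close>

lemma derivs_cases:
  assumes "P \<in> derivs i" "i \<le> d"
  obtains (binary) a where "a \<le> i" "P = D i a"
  | (mixed) t where "\<And>j. j \<le> n \<Longrightarrow> t j \<in> pl i"
      "P = (\<Sum>a\<le>d - i. mscale (\<Sum>j\<le>n. phi j (t j * monom 1 a)) (E (d - i) a))"
proof -
  obtain m where m: "keys m \<subseteq> {..n+2}" "tdeg m = i" and P: "P = pdiffs m f"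
    using assms(1) by (auto simp: derivs_def)
  show ?thesis
  proof (cases "\<forall>j\<le>n. lookup m j = 0")
    case True
    then show ?thesis
      using tdeg_mon_eq[OF m(1) _ m(2)] P binary[of "lookup m (n + 1)"] by (auto simp: D_def)
  next
    case False
    then have hz: "hz n m = (0 :: 'k poly)"
      unfolding hz_def by (rule if_not_P)
    have \<theta>: "single m 1 \<in> Rdeg n i"
      using m by (rule forms_single)
    show ?thesis
    proof (rule mixed)
      show "evy n j (single m 1) \<in> pl i" if "j \<le> n" for j
        using evy_pl[OF \<theta> that] .
      show "P = (\<Sum>a\<le>d - i. mscale (\<Sum>j\<le>n. phi j (evy n j (single m 1) * monom 1 a)) (E (d - i) a))"
        using act_f_expand[OF \<theta> assms(2)]
        by (simp add: P pdiffs_eq_act ev_single hz zero_annih lin_zero[OF lin_gam])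
    qed
  qed
qed

definition bin :: "nat \<Rightarrow> 'k poly \<Rightarrow> 'k mpoly" where
  "bin i t = (\<Sum>a\<le>i. single (mon n a (i - a)) (coeff t a))"

lemma bin_forms: "bin i t \<in> Rdeg n i"
proof -
  have "keys (mon n a b) \<subseteq> {..n+2}" for a b
    using keys_mon[of n a b] by auto
  then show ?thesis
    unfolding bin_def by (intro forms_sum forms_single) (auto simp: tdeg_mon)
qed

lemma ev_bin: "t \<in> pl (Suc i) \<Longrightarrow> ev n (bin i t) = t"
  using poly_as_sum_pl[of t "Suc i"]
  by (simp only: bin_def ev_sum ev_single hz_mon smult_monom mult_1_right lessThan_Suc_atMost)

lemma act_bin: "act (bin i t) f = (\<Sum>a\<le>i. mscale (coeff t a) (D i a))"
  by (simp add: bin_def act_sum act_single D_def)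

text \<open>There are \<open>(d - i + 1) + (i + 1) = d + 2\<close> generators, which is the bound on
  the \<open>h\<close>-vector.\<close>

lemma derivs_subset_span: "i \<le> d \<Longrightarrow> derivs i \<subseteq> mpoly.span (E (d - i) ` {..d - i} \<union> D i ` {..i})"
proof
  fix P assume "i \<le> d" "P \<in> derivs i"
  from this(2,1) show "P \<in> mpoly.span (E (d - i) ` {..d - i} \<union> D i ` {..i})"
  proof (cases rule: derivs_cases)
    case (binary a)
    then show ?thesis by (auto intro: mpoly.span_base)
  next
    case (mixed t)
    show ?thesis unfolding mixed(2)
      by (intro mpoly.span_sum mpoly.span_scale mpoly.span_base) auto
  qed
qed

text \<open>The operator \<open>t\<close> turns a combination of the \<open>D i a\<close> into a
  binary form, so one \<open>D i a0\<close> with nonzero coefficient is redundant.\<close>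

lemma hvec_less_of_annW:
  assumes "i \<le> d" and t: "t \<in> annW i" "t \<noteq> 0"
  shows "hvec n f i < d + 2"
proof -
  obtain a0 where a0: "a0 \<le> i" "coeff t a0 \<noteq> 0"
    using annih_pl[OF t(1)] t(2) by (metis leading_coeff_0_iff less_Suc_eq_le pl_iff_degree)
  let ?B = "E (d - i) ` {..d - i} \<union> D i ` ({..i} - {a0})"
  have ev: "ev n (bin i t) = t"
    by (rule ev_bin[OF annih_pl[OF t(1)]])
  have "act (bin i t) f = (\<Sum>a\<le>d - i. mscale (gam (t * monom 1 a) + (\<Sum>j\<le>n. phi j (evy n j (bin i t) * monom 1 a))) (E (d - i) a))"
    using act_f_expand[OF bin_forms assms(1), of t] ev t(1) by simp
  also have "\<dots> \<in> mpoly.span ?B"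
    by (intro mpoly.span_sum mpoly.span_scale mpoly.span_base) auto
  finally have "act (bin i t) f \<in> mpoly.span ?B" .
  moreover have "(\<Sum>a\<in>{..i} - {a0}. mscale (coeff t a) (D i a)) \<in> mpoly.span ?B"
    by (intro mpoly.span_sum mpoly.span_scale mpoly.span_base) auto
  ultimately have "act (bin i t) f - (\<Sum>a\<in>{..i} - {a0}. mscale (coeff t a) (D i a)) \<in> mpoly.span ?B"
    by (rule mpoly.span_diff)
  also have "act (bin i t) f - (\<Sum>a\<in>{..i} - {a0}. mscale (coeff t a) (D i a)) = mscale (coeff t a0) (D i a0)"
    unfolding act_bin using a0 by (subst sum.remove[of "{..i}" a0]) auto
  finally have "mscale (coeff t a0) (D i a0) \<in> mpoly.span ?B" .
  then have "mscale (inverse (coeff t a0)) (mscale (coeff t a0) (D i a0)) \<in> mpoly.span ?B"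
    by (rule mpoly.span_scale)
  then have "D i a0 \<in> mpoly.span ?B"
    using a0 by simp
  then have "E (d - i) ` {..d - i} \<union> D i ` {..i} \<subseteq> mpoly.span ?B"
    by (auto intro: mpoly.span_base)
  then have "mpoly.span (E (d - i) ` {..d - i} \<union> D i ` {..i}) \<subseteq> mpoly.span ?B"
    by (rule mpoly.span_minimal[OF _ mpoly.subspace_span])
  with derivs_subset_span[OF assms(1)] have "derivs i \<subseteq> mpoly.span ?B"
    by (rule order_trans)
  then have "hvec n f i \<le> card ?B"
    unfolding hvec_eq by (rule mpoly.dim_le_card) auto
  also have "\<dots> \<le> card (E (d - i) ` {..d - i}) + card (D i ` ({..i} - {a0}))"
    by (rule card_Un_le)
  also have "\<dots> \<le> card {..d - i} + card ({..i} - {a0})"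
    by (intro add_mono card_image_le) auto
  also have "\<dots> = Suc d"
    using a0 assms(1) by simp
  finally show ?thesis by simp
qed

text \<open>The mixed derivatives are binary forms killed by \<open>\<eta>\<close>, so they lie in a
  hyperplane and one generator can be saved.\<close>

lemma hvec_less_of_annW_dual:
  assumes "i \<le> d" and \<eta>: "\<eta> \<in> annW (d - i)" "\<eta> \<noteq> 0"
  shows "hvec n f i < d + 2"
proof -
  obtain b0 where b0: "b0 \<le> d - i" "coeff \<eta> b0 \<noteq> 0"
    using annih_pl[OF \<eta>(1)] \<eta>(2) by (metis leading_coeff_0_iff less_Suc_eq_le pl_iff_degree)
  \<comment> \<open>A basis of that hyperplane: the multiple of \<open>E (d - i) b0\<close> is
    chosen so that \<open>\<eta>\<close> kills the difference.\<close>
  define E' where "E' b = E (d - i) b - mscale (coeff \<eta> b / coeff \<eta> b0) (E (d - i) b0)" for b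
  let ?B = "D i ` {..i} \<union> E' ` ({..d - i} - {b0})"
  have "derivs i \<subseteq> mpoly.span ?B"
  proof
    fix P assume "P \<in> derivs i"
    then show "P \<in> mpoly.span ?B" using assms(1)
    proof (cases rule: derivs_cases)
      case (binary a)
      then show ?thesis by (auto intro: mpoly.span_base)
    next
      case (mixed t)
      define x where "x b = (\<Sum>j\<le>n. phi j (t j * monom 1 b))" for b
      have "phi j (\<eta> * t j) = (\<Sum>b\<le>d - i. coeff \<eta> b * phi j (t j * monom 1 b))" for j
        using poly_mult_as_sum_pl[OF lin_phi annih_pl[OF \<eta>(1)], of j "t j"]
        by (simp only: lessThan_Suc_atMost mult.commute)
      moreover have "phi j (\<eta> * t j) = 0" if "j \<le> n" for j
        using annihD[OF \<eta>(1)] mixed(1)[OF that] that assms(1) by simp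
      ultimately have "(\<Sum>j\<le>n. \<Sum>b\<le>d - i. coeff \<eta> b * phi j (t j * monom 1 b)) = 0"
        by (intro sum.neutral) simp
      then have "(\<Sum>b\<le>d - i. coeff \<eta> b * x b) = 0"
        by (subst (asm) sum.swap) (simp add: x_def sum_distrib_left)
      then have "coeff \<eta> b0 * x b0 + (\<Sum>b\<in>{..d - i} - {b0}. coeff \<eta> b * x b) = 0"
        using b0 by (subst (asm) sum.remove[of _ b0]) auto
      then have x0: "x b0 = - (\<Sum>b\<in>{..d - i} - {b0}. x b * (coeff \<eta> b / coeff \<eta> b0))"
        using b0 by (simp add: field_simps sum_divide_distrib[symmetric] eq_neg_iff_add_eq_0)
      have "P = mscale (x b0) (E (d - i) b0) + (\<Sum>b\<in>{..d - i} - {b0}. mscale (x b) (E (d - i) b))"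
        unfolding mixed(2) x_def using b0 by (subst sum.remove[of _ b0]) auto
      also have "\<dots> = (\<Sum>b\<in>{..d - i} - {b0}. mscale (x b) (E' b))"
        unfolding x0 E'_def
        by (simp add: mpoly.scale_right_diff_distrib sum_subtractf mpoly.scale_minus_left mpoly.scale_sum_left)
      also have "\<dots> \<in> mpoly.span ?B"
        by (intro mpoly.span_sum mpoly.span_scale mpoly.span_base) auto
      finally show ?thesis .
    qed
  qed
  then have "hvec n f i \<le> card ?B"
    unfolding hvec_eq by (rule mpoly.dim_le_card) auto
  also have "\<dots> \<le> card (D i ` {..i}) + card (E' ` ({..d - i} - {b0}))"
    by (rule card_Un_le)
  also have "\<dots> \<le> card {..i} + card ({..d - i} - {b0})"
    by (intro add_mono card_image_le) auto
  also have "\<dots> = Suc d"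
    using b0 assms(1) by simp
  finally show ?thesis by simp
qed

text \<open>By \<open>phi_represents\<close> every \<open>E (d - i) b\<close> is a combination of
  derivatives. In a linear relation, the monomials with one \<open>x_j\<close> force the
  \<open>D\<close> part to come from \<open>annW i\<close>, hence to vanish, and the
  \<open>E\<close> part is independent.\<close>

lemma hvec_maximal:
  assumes "i \<le> d" "annW i \<subseteq> {0}" "annW (d - i) \<subseteq> {0}"
  shows "hvec n f i = d + 2"
proof -
  \<comment> \<open>A disjoint sum of index sets counts both families without first showing them
    distinct.\<close>
  let ?I = "{..d - i} <+> {..i}"
  let ?B = "case_sum (E (d - i)) (D i)"
  have image: "?B ` ?I = E (d - i) ` {..d - i} \<union> D i ` {..i}"
    by (auto simp: Plus_def image_Un image_image)
  have sum_I: "(\<Sum>x\<in>?I. mscale (c x) (?B x))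
      = (\<Sum>a\<le>d - i. mscale (c (Inl a)) (E (d - i) a)) + (\<Sum>a\<le>i. mscale (c (Inr a)) (D i a))" for c
    by (simp add: sum.Plus)
  have "E (d - i) b \<in> mpoly.span (derivs i)" if b: "b \<le> d - i" for b
  proof -
    have "lin (\<lambda>w. coeff w b)" by (simp add: lin_def)
    then obtain t where t: "\<And>j. j \<le> n \<Longrightarrow> t j \<in> pl i"
      and eq: "\<And>w. w \<in> pl (Suc (d - i)) \<Longrightarrow> coeff w b = (\<Sum>j\<le>n. phi j (t j * w))"
      using phi_represents[OF assms(3,1)] by blast
    obtain \<theta> where \<theta>: "\<theta> \<in> Rdeg n i" "ev n \<theta> = 0" "\<And>j. j \<le> n \<Longrightarrow> evy n j \<theta> = t j"
      using ev_lift[of 0 i n t] t by auto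
    have "act \<theta> f = (\<Sum>a\<le>d - i. mscale (gam 0 + (\<Sum>j\<le>n. phi j (evy n j \<theta> * monom 1 a))) (E (d - i) a))"
      using act_f_expand[OF \<theta>(1) assms(1)] \<theta>(2) zero_annih by simp
    also have "\<dots> = (\<Sum>a\<le>d - i. mscale (coeff (monom 1 a) b) (E (d - i) a))"
    proof (intro sum.cong refl)
      fix a assume "a \<in> {..d - i}"
      then have "coeff (monom 1 a) b = (\<Sum>j\<le>n. phi j (t j * monom 1 a))"
        by (intro eq pl_monom) auto
      then show "mscale (gam 0 + (\<Sum>j\<le>n. phi j (evy n j \<theta> * monom 1 a))) (E (d - i) a) = mscale (coeff (monom 1 a) b) (E (d - i) a)"
        using \<theta>(3) by (simp add: lin_zero[OF lin_gam])
    qed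
    also have "\<dots> = (\<Sum>a\<le>d - i. if a = b then E (d - i) a else 0)"
      by (intro sum.cong) auto
    also have "\<dots> = E (d - i) b"
      using b by simp
    finally show ?thesis
      using act_in_span[OF \<theta>(1)] by simp
  qed
  moreover have "D i a \<in> mpoly.span (derivs i)" if "a \<le> i" for a
    unfolding D_def derivs_def using that keys_mon[of n a "i - a"]
    by (intro mpoly.span_base CollectI exI[of _ "mon n a (i - a)"]) (auto simp: tdeg_mon)
  ultimately have "?B ` ?I \<subseteq> mpoly.span (derivs i)"
    unfolding image by auto
  moreover have "derivs i \<subseteq> mpoly.span (?B ` ?I)"
    unfolding image by (rule derivs_subset_span[OF assms(1)])
  ultimately have "mpoly.span (derivs i) = mpoly.span (?B ` ?I)"
    by (simp add: mpoly.span_eq)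
  then have "hvec n f i = mpoly.dim (mpoly.span (?B ` ?I))"
    unfolding hvec_eq by (metis mpoly.dim_span)
  also have "\<dots> = card ?I"
  proof (rule mpoly.dim_span_family)
    fix c assume "(\<Sum>x\<in>?I. mscale (c x) (?B x)) = 0"
    then have 0: "(\<Sum>a\<le>d - i. mscale (c (Inl a)) (E (d - i) a)) + (\<Sum>a\<le>i. mscale (c (Inr a)) (D i a)) = 0"
      by (simp only: sum_I)
    define t where "t = (\<Sum>a\<le>i. monom (c (Inr a)) a)"
    have t: "t \<in> pl (Suc i)"
      unfolding t_def by (intro pl_sum pl_monom) auto
    have coeff_t: "coeff t a = c (Inr a)" if "a \<le> i" for a
      using that by (simp add: t_def coeff_sum)
    have dpc0: "dpc (\<Sum>a\<le>d - i. mscale (c (Inl a)) (E (d - i) a)) k + dpc (act (bin i t) f) k = 0" for k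
    proof -
      have "act (bin i t) f = (\<Sum>a\<le>i. mscale (c (Inr a)) (D i a))"
        unfolding act_bin using coeff_t by (intro sum.cong) auto
      then show ?thesis
        using arg_cong[OF 0, of "\<lambda>P. dpc P k"] by (simp add: dpc_add dpc_0)
    qed
    have "phi j (t * monom 1 a) = 0" if j: "j \<le> n" and a: "a < d - i" for j a
    proof -
      \<comment> \<open>This monomial contains \<open>x_j\<close>, so it occurs in no
        \<open>E (d - i) b\<close> and isolates one test of \<open>t\<close>.\<close>
      let ?k = "single j 1 + mon n a (d - i - 1 - a)"
      have k: "keys ?k \<subseteq> {..n+2}" "tdeg ?k = d - i"
        using j a keys_mon[of n a "d - i - 1 - a"] by (auto simp: keys_add_nat tdeg_add tdeg_single tdeg_mon)
      have "lookup ?k j \<noteq> 0"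
        by (simp add: lookup_add)
      then have "?k \<noteq> mon n b b'" for b b'
        using j by (metis lookup_mon Suc_eq_plus1 add_2_eq_Suc' le_SucI not_less_eq_eq)
      then have "dpc (act (bin i t) f) ?k = 0"
        using dpc0[of ?k] by (simp add: dpc_sum_E)
      moreover have "dpc (act (bin i t) f) ?k = (\<Sum>j'\<le>n. phi j' (t * hy n j' ?k))"
        using dpc_act_f(1)[OF bin_forms assms(1) k, of t] j
        by (simp only: ev_bin[OF t] hz_y_mon mult_zero_right lin_zero[OF lin_gam] lin_zero[OF lin_phi] sum.neutral_const add_0_left)
      moreover have "(\<Sum>j'\<le>n. phi j' (t * hy n j' ?k)) = (\<Sum>j'\<le>n. if j' = j then phi j (t * monom 1 a) else 0)"
        using j by (intro sum.cong refl) (simp add: hy_y_mon lin_zero[OF lin_phi])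
      ultimately show ?thesis using j by simp
    qed
    then have "phi j (t * w) = 0" if "j \<le> n" "w \<in> pl (d - i)" for j w
      using poly_mult_as_sum_pl[OF lin_phi that(2), of j t] that(1) by (simp add: mult.commute)
    then have "t \<in> annW i"
      using t by (auto simp: annih_def)
    then have t0: "t = 0" using assms(2) by auto
    have "c (Inl b) = 0" if "b \<le> d - i" for b
    proof -
      have "bin i t = 0" by (simp add: bin_def t0)
      then have "dpc (\<Sum>a\<le>d - i. mscale (c (Inl a)) (E (d - i) a)) (mon n b (d - i - b)) = 0"
        using dpc0[of "mon n b (d - i - b)"] by (simp add: act_zero dpc_0)
      moreover have ex: "\<exists>a\<le>d - i. mon n b (d - i - b) = mon n a (d - i - a)"
        using that by blast
      ultimately show ?thesis
        unfolding dpc_sum_E if_P[OF ex] by (simp add: lookup_mon)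
    qed
    moreover have "c (Inr a) = 0" if "a \<le> i" for a
      using coeff_t[OF that] t0 by simp
    ultimately show "\<forall>x\<in>?I. c x = 0" by auto
  qed simp
  also have "\<dots> = d + 2"
    using assms(1) by (simp add: card_Plus)
  finally show ?thesis .
qed

lemma hvec_eq_iff: "i \<le> d \<Longrightarrow> hvec n f i = d + 2 \<longleftrightarrow> i < init_deg \<and> d - i < init_deg"
  using hvec_maximal[of i] hvec_less_of_annW[of i] hvec_less_of_annW_dual[of i]
  by (metis annW_eq_0_iff less_irrefl singletonI subsetI)

end

theorem theorem4p9:
  fixes n d :: nat and p :: "nat \<Rightarrow> 'k::field_char_0 mpoly" and g :: "'k mpoly"
  assumes "alg_closed_field TYPE('k)"
    and "n \<ge> 2" and "d \<ge> n + 1"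
    and "perazzo n d p g"
  shows "has_WLP n (perazzo_form n p g) \<longleftrightarrow>
         card {i. i \<le> d \<and> hvec n (perazzo_form n p g) i = d + 2} \<le> 1"
proof -
  interpret perazzo_setup n d p g
    using assms by unfold_locales auto
  have "{i. i \<le> d \<and> hvec n f i = d + 2} = {Suc d - init_deg..<init_deg}"
    using hvec_eq_iff init_deg_le by auto
  \<comment> \<open>Even with truncated subtraction, this number is at most \<open>1\<close> exactly
    when \<open>2 * init_deg \<le> d + 2\<close>.\<close>
  then have "card {i. i \<le> d \<and> hvec n f i = d + 2} = 2 * init_deg - Suc d"
    using init_deg_le by simp
  then show ?thesis
    unfolding WLP_iff_init_deg by auto
qed

end
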